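(* Let $W:\mathcal{X}\to\mathcal{S}(B)$ be a cq-channel all of whose outputs are pure states, i.e. $W_x=|\psi_x\rangle\langle\psi_x|$ for unit vectors $|\psi_x\rangle\in B$, and let $\widetilde{\mathcal{X}}=W(\mathcal{X})$. Then \[ \dot{C}_{\rm DI}(W)=\frac12\,\underline{d}_M\!\left(\sqrt{\widetilde{\mathcal{X}}}\right)=\frac12\,\underline{d}_M\!\left(\widetilde{\mathcal{X}}\right). \]
   Context: A cq-channel is a measurable map $W:\mathcal{X}\to\mathcal{S}(B)$ from a measure space $\mathcal{X}$ to density operators on a finite-dimensional Hilbert space $B$; $W_{x^n}=W_{x_1}\otimes\cdots\otimes W_{x_n}$. An $(n,N,\lambda_1,\lambda_2)$-DI code for $W$ is $\{(u_j,E_j):j\in[N]\}$, $u_j\in\mathcal{X}^n$, $0\le E_j\le\mathbb{1}$ on $B^{\otimes n}$, with $\operatorname{Tr}W_{u_j}E_j\ge1-\lambda_1$ and $\operatorname{Tr}W_{u_j}E_k\le\lambda_2$ for all $j\ne k$; $N_{\rm DI}(n,\lambda_1,\lambda_2)$ is the largest such $N$, and $\dot{C}_{\rm DI}(W)=\inf_{\lambda_1,\lambda_2>0}\liminf_{n\to\infty}\frac{1}{n\log n}\log N_{\rm DI}(n,\lambda_1,\lambda_2)$ (logs base 2). $\sqrt{\widetilde{\mathcal{X}}}=\{\sqrt{\sigma}:\sigma\in\widetilde{\mathcal{X}}\}$. For a set $F$ of operators metrized by the Hilbert–Schmidt norm $\|X\|_2=\sqrt{\operatorname{Tr}X^*X}$,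 $\Pi_\delta(F)$ is the maximal number of points of $F$ with pairwise distance at least $\delta$, and $\underline{d}_M(F)=\liminf_{\delta\to0}\frac{\log\Pi_\delta(F)}{-\log\delta}$ is the lower Minkowski dimension. *)

theory Defs
  imports Complex_Main "HOL-Library.Extended_Real" "HOL-Library.Liminf_Limsup"
    "Jordan_Normal_Form.Matrix"
begin

text \<open>Operators on the d-dimensional Hilbert space B = C^d are d x d complex matrices.
  B^{\<otimes>n} is C^(d^n) with the Kronecker product.\<close>

definition mtrace :: "complex mat \<Rightarrow> complex" where
  "mtrace A = (\<Sum>i<dim_row A. A $$ (i, i))"

definition madj :: "complex mat \<Rightarrow> complex mat" where
  "madj A = mat (dim_col A) (dim_row A) (\<lambda>(i, j). cnj (A $$ (j, i)))"

definition psd :: "nat \<Rightarrow> complex mat \<Rightarrow> bool" where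
  "psd d A \<longleftrightarrow> A \<in> carrier_mat d d \<and>
     (\<forall>v \<in> carrier_vec d.
        let q = (\<Sum>i<d. \<Sum>j<d. cnj (v $ i) * A $$ (i, j) * v $ j) in Im q = 0 \<and> Re q \<ge> 0)"

definition density :: "nat \<Rightarrow> complex mat \<Rightarrow> bool" where
  "density d \<rho> \<longleftrightarrow> psd d \<rho> \<and> mtrace \<rho> = 1"

definition kron :: "complex mat \<Rightarrow> complex mat \<Rightarrow> complex mat" where
  "kron A B = mat (dim_row A * dim_row B) (dim_col A * dim_col B)
     (\<lambda>(i, j). A $$ (i div dim_row B, j div dim_col B) * B $$ (i mod dim_row B, j mod dim_col B))"

definition tensor_word :: "('a \<Rightarrow> complex mat) \<Rightarrow> 'a list \<Rightarrow> complex mat" where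
  "tensor_word W xs = foldr (\<lambda>x M. kron (W x) M) xs (1\<^sub>m 1)"

definition cq_channel :: "nat \<Rightarrow> 'a set \<Rightarrow> ('a \<Rightarrow> complex mat) \<Rightarrow> bool" where
  "cq_channel d X W \<longleftrightarrow> (\<forall>x \<in> X. density d (W x))"

definition proj_vec :: "nat \<Rightarrow> complex vec \<Rightarrow> complex mat" where
  "proj_vec d \<psi> = mat d d (\<lambda>(i, j). \<psi> $ i * cnj (\<psi> $ j))"

definition unit_vector :: "nat \<Rightarrow> complex vec \<Rightarrow> bool" where
  "unit_vector d \<psi> \<longleftrightarrow> \<psi> \<in> carrier_vec d \<and> (\<Sum>i<d. (cmod (\<psi> $ i))\<^sup>2) = 1"

definition DI_code ::
  "nat \<Rightarrow> 'a set \<Rightarrow> ('a \<Rightarrow> complex mat) \<Rightarrow> nat \<Rightarrow> nat \<Rightarrow> real \<Rightarrow> real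
     \<Rightarrow> (nat \<Rightarrow> 'a list) \<Rightarrow> (nat \<Rightarrow> complex mat) \<Rightarrow> bool" where
  "DI_code d X W n N l1 l2 u E \<longleftrightarrow>
     (\<forall>j<N. length (u j) = n \<and> set (u j) \<subseteq> X \<and>
        psd (d ^ n) (E j) \<and> psd (d ^ n) (1\<^sub>m (d ^ n) - E j) \<and>
        Re (mtrace (tensor_word W (u j) * E j)) \<ge> 1 - l1 \<and>
        (\<forall>k<N. k \<noteq> j \<longrightarrow> Re (mtrace (tensor_word W (u j) * E k)) \<le> l2))"

definition N_DI :: "nat \<Rightarrow> 'a set \<Rightarrow> ('a \<Rightarrow> complex mat) \<Rightarrow> nat \<Rightarrow> real \<Rightarrow> real \<Rightarrow> enat" where
  "N_DI d X W n l1 l2 = Sup {enat N | N. \<exists>u E. DI_code d X W n N l1 l2 u E}"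

definition elog2 :: "enat \<Rightarrow> ereal" where
  "elog2 N = (case N of enat k \<Rightarrow> ereal (log 2 (real k)) | \<infinity> \<Rightarrow> \<infinity>)"

definition C_DI_dot :: "nat \<Rightarrow> 'a set \<Rightarrow> ('a \<Rightarrow> complex mat) \<Rightarrow> ereal" where
  "C_DI_dot d X W = (INF l\<in>{0<..} \<times> {0<..}.
     liminf (\<lambda>n. elog2 (N_DI d X W n (fst l) (snd l)) / ereal (real n * log 2 (real n))))"

definition mat_sqrt :: "complex mat \<Rightarrow> complex mat" where
  "mat_sqrt A = (THE B. psd (dim_row A) B \<and> B * B = A)"

definition hs_dist :: "complex mat \<Rightarrow> complex mat \<Rightarrow> real" where
  "hs_dist A B = sqrt (Re (mtrace (madj (A - B) * (A - B))))"

definition packing_number :: "complex mat set \<Rightarrow> real \<Rightarrow> enat" where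
  "packing_number F \<delta> = Sup {enat (card S) | S. S \<subseteq> F \<and> finite S \<and>
      (\<forall>A\<in>S. \<forall>B\<in>S. A \<noteq> B \<longrightarrow> hs_dist A B \<ge> \<delta>)}"

definition lower_minkowski_dim :: "complex mat set \<Rightarrow> ereal" where
  "lower_minkowski_dim F =
     Liminf (at_right 0) (\<lambda>\<delta>. elog2 (packing_number F \<delta>) / ereal (- log 2 \<delta>))"

end

theory Submission
  imports Defs "HOL-Analysis.L2_Norm" "HOL-Real_Asymp.Real_Asymp"
begin

text \<open>A rank-one projection is its own square root, so only the channel outputs themselves matter,
  and for pure states the squared Hilbert--Schmidt distance is \<open>2 - 2 F\<close> with the fidelity
  \<open>F = |\<langle>\<psi>\<^sub>x, \<psi>\<^sub>y\<rangle>|\<^sup>2\<close>, which is multiplicative on words.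

  Lower bound: over a \<open>\<delta>\<close>-packing with \<open>\<delta> = n powr (- (1 - s) / 2)\<close> take a
  Gilbert--Varshamov code of relative distance \<open>s\<close> and let each word be tested by its own
  projection. Distinct words have fidelity at most \<open>(1 - \<delta>\<^sup>2 / 2) ^ (s n) \<le> exp (- s n powr s / 2)\<close>
  (up to rounding \<open>s n\<close>), which tends to zero, and the rate is \<open>1/2\<close> of the dimension as \<open>s \<rightarrow> 0\<close>.

  Upper bound: an effect separating two pure states with error probabilities \<open>1/4\<close> forces
  \<open>1 - F \<ge> 1/8\<close>, whereas two words whose letters are pairwise at distance at most \<open>2 \<delta>\<close> have
  \<open>1 - F \<le> 2 n \<delta>\<^sup>2\<close>. With \<open>\<delta> = 1 / (5 \<surd>n)\<close>, rounding letters to a maximal packing is therefore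
  injective on codewords, and the code has at most \<open>\<Pi>\<^sub>\<delta> ^ n\<close> words.\<close>

section \<open>Inner products and pure states\<close>

text \<open>Vectors are functions of which only the first \<open>n\<close> values count, so sums and
  multiples of vectors are plain lambda terms without dimension conditions. The form is conjugate
  linear in its first argument.\<close>

definition ip :: "nat \<Rightarrow> (nat \<Rightarrow> complex) \<Rightarrow> (nat \<Rightarrow> complex) \<Rightarrow> complex" where
  "ip n f g = (\<Sum>i<n. cnj (f i) * g i)"

definition sesq :: "nat \<Rightarrow> complex mat \<Rightarrow> (nat \<Rightarrow> complex) \<Rightarrow> (nat \<Rightarrow> complex) \<Rightarrow> complex" where
  "sesq n A f g = (\<Sum>i<n. \<Sum>j<n. cnj (f i) * A $$ (i, j) * g j)"

lemma cnj_ip: "cnj (ip n f g) = ip n g f"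
  by (simp add: ip_def mult.commute)

lemma ip_self: "ip n f f = of_real (\<Sum>i<n. (cmod (f i))\<^sup>2)"
  unfolding ip_def of_real_sum
  by (rule sum.cong) (simp_all add: complex_norm_square mult.commute flip: of_real_power)

lemma ip_self_nonneg: "0 \<le> Re (ip n f f)"
  by (simp add: ip_self sum_nonneg)

lemma ip_mult_cnj: "ip n f g * ip n g f = of_real ((cmod (ip n f g))\<^sup>2)"
  by (metis cnj_ip complex_norm_square of_real_power)

lemma cmod_ip_commute: "cmod (ip n f g) = cmod (ip n g f)"
  by (metis cnj_ip complex_mod_cnj)

lemma ip_diff_scale_right: "ip n f (\<lambda>i. g i - c * h i) = ip n f g - c * ip n f h"
  by (simp add: ip_def right_diff_distrib sum_subtractf sum_distrib_left mult.left_commute)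

lemma ip_diff_scale_left: "ip n (\<lambda>i. g i - c * h i) f = ip n g f - cnj c * ip n h f"
  by (simp add: ip_def left_diff_distrib sum_subtractf sum_distrib_left mult.assoc)

text \<open>Pythagoras for the component of \<open>f\<close> along the unit vector \<open>g\<close>
  and the remainder orthogonal to it.\<close>

lemma ip_residual:
  assumes "ip n g g = 1"
  shows "Re (ip n (\<lambda>i. f i - ip n g f * g i) (\<lambda>i. f i - ip n g f * g i))
       = Re (ip n f f) - (cmod (ip n g f))\<^sup>2"
  by (simp add: ip_diff_scale_left ip_diff_scale_right assms cnj_ip mult.commute[of "ip n f g"]
      ip_mult_cnj)

lemma ip_Bessel:
  assumes "ip n g g = 1"
  shows "(cmod (ip n g f))\<^sup>2 \<le> Re (ip n f f)"
  using ip_residual[OF assms, of f] ip_self_nonneg[of n "\<lambda>i. f i - ip n g f * g i"] by linarith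

lemma sesq_parallelogram:
  "sesq n A (\<lambda>i. f i + g i) (\<lambda>i. f i + g i) + sesq n A (\<lambda>i. f i - g i) (\<lambda>i. f i - g i)
   = 2 * sesq n A f f + 2 * sesq n A g g"
  unfolding sesq_def sum_distrib_left sum.distrib[symmetric]
  by (intro sum.cong refl) (simp add: algebra_simps)

lemma sesq_scale:
  "sesq n A (\<lambda>i. c * f i) (\<lambda>i. c * f i) = of_real ((cmod c)\<^sup>2) * sesq n A f f"
  unfolding sesq_def sum_distrib_left complex_norm_square
  by (intro sum.cong refl) (simp add: mult_ac)

lemma sesq_one_minus:
  assumes "A \<in> carrier_mat n n"
  shows "sesq n (1\<^sub>m n - A) f g = ip n f g - sesq n A f g"
proof -
  have "sesq n (1\<^sub>m n - A) f g
      = (\<Sum>i<n. \<Sum>j<n. (if i = j then cnj (f i) * g j else 0) - cnj (f i) * A $$ (i, j) * g j)"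
    unfolding sesq_def using assms by (intro sum.cong refl) (auto simp: algebra_simps)
  then show ?thesis
    by (simp add: sum_subtractf ip_def sesq_def)
qed

section \<open>Positive matrices and effects evaluated on pure states\<close>

lemma psd_iff_sesq:
  "psd n A \<longleftrightarrow> A \<in> carrier_mat n n \<and> (\<forall>f. Im (sesq n A f f) = 0 \<and> 0 \<le> Re (sesq n A f f))"
proof -
  have *: "sesq n A f f = (\<Sum>i<n. \<Sum>j<n. cnj (vec n f $ i) * A $$ (i, j) * vec n f $ j)" for f
    unfolding sesq_def by (intro sum.cong refl) simp
  have "(\<forall>v\<in>carrier_vec n. let q = (\<Sum>i<n. \<Sum>j<n. cnj (v $ i) * A $$ (i, j) * v $ j)
          in Im q = 0 \<and> Re q \<ge> 0) \<longleftrightarrow> (\<forall>f. Im (sesq n A f f) = 0 \<and> 0 \<le> Re (sesq n A f f))"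
    (is "?L = ?R")
  proof
    assume L: ?L
    show ?R
      using bspec[OF L vec_carrier[of n]] by (simp add: * Let_def)
  next
    assume ?R
    then show ?L unfolding Let_def sesq_def by blast
  qed
  then show ?thesis unfolding psd_def by blast
qed

text \<open>Polarization: the form is real on \<open>e i + e j\<close>, which ties the imaginary
  parts of the two entries, and on \<open>e i + \<i> * e j\<close>, which ties their real
  parts.\<close>

lemma psd_hermitian:
  assumes "psd n A" "i < n" "j < n"
  shows "cnj (A $$ (i, j)) = A $$ (j, i)"
proof -
  have im: "Im (sesq n A f f) = 0" for f using assms(1) by (simp add: psd_iff_sesq)
  define e where "e k l = (if l = k then 1 else 0 :: complex)" for k l :: nat
  have ee: "sesq n A (e k) (e l) = A $$ (k, l)" if "k < n" "l < n" for k l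
    using that by (simp add: sesq_def e_def if_distrib[of cnj] if_distrib[of "\<lambda>x. x * _"]
        if_distrib[of "\<lambda>x. _ * x"] cong: if_cong)
  have exp: "sesq n A (\<lambda>l. e i l + c * e j l) (\<lambda>l. e i l + c * e j l)
     = sesq n A (e i) (e i) + c * sesq n A (e i) (e j) + cnj c * sesq n A (e j) (e i)
       + cnj c * c * sesq n A (e j) (e j)" for c
    unfolding sesq_def sum_distrib_left sum.distrib[symmetric]
    by (intro sum.cong refl) (simp add: algebra_simps)
  have d: "Im (A $$ (i, i)) = 0" "Im (A $$ (j, j)) = 0"
    using im[of "e i"] im[of "e j"] ee assms by auto
  have "Im (A $$ (i, j)) + Im (A $$ (j, i)) = 0"
    using im[of "\<lambda>l. e i l + 1 * e j l"] unfolding exp using d assms by (simp add: ee)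
  moreover have "Re (A $$ (i, j)) - Re (A $$ (j, i)) = 0"
    using im[of "\<lambda>l. e i l + \<i> * e j l"] unfolding exp using d assms by (simp add: ee)
  ultimately show ?thesis by (simp add: complex_eq_iff)
qed

text \<open>Split \<open>f\<close> into its component \<open>a\<close> along \<open>g\<close> and
  the orthogonal rest \<open>b\<close>. The parallelogram law without its nonnegative term at
  \<open>a - b\<close> costs the factor 2. The part along \<open>g\<close> is at most the value at
  \<open>g\<close> since its coefficient has modulus at most 1, and the rest is at most its squared
  norm since \<open>E\<close> is below the identity.\<close>

lemma effect_pure_bound:
  assumes "psd n E" "psd n (1\<^sub>m n - E)" "ip n f f = 1" "ip n g g = 1"
  shows "Re (sesq n E f f) \<le> 2 * Re (sesq n E g g) + 2 * (1 - (cmod (ip n g f))\<^sup>2)"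
proof -
  define c where "c = ip n g f"
  define a where "a = (\<lambda>i. c * g i)"
  define b where "b = (\<lambda>i. f i - c * g i)"
  have E: "E \<in> carrier_mat n n" using assms(1) by (simp add: psd_def)
  have nn: "0 \<le> Re (sesq n E h h)" for h using assms(1) by (simp add: psd_iff_sesq)
  have le: "Re (sesq n E h h) \<le> Re (ip n h h)" for h
    using assms(2) sesq_one_minus[OF E, of h h] unfolding psd_iff_sesq
    by (metis diff_ge_0_iff_ge minus_complex.simps(1))
  have "f = (\<lambda>i. a i + b i)" by (auto simp: a_def b_def)
  then have "Re (sesq n E f f) \<le> 2 * Re (sesq n E a a) + 2 * Re (sesq n E b b)"
    using arg_cong[OF sesq_parallelogram[of n E a b], of Re] nn[of "\<lambda>i. a i - b i"] by simp
  moreover have "Re (sesq n E a a) \<le> Re (sesq n E g g)"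
  proof -
    have "(cmod c)\<^sup>2 \<le> 1" using ip_Bessel[OF assms(4), of f] assms(3) by (simp add: c_def)
    then show ?thesis unfolding a_def sesq_scale using nn[of g]
      by (simp add: mult_left_le_one_le del: of_real_power)
  qed
  moreover have "Re (sesq n E b b) \<le> 1 - (cmod c)\<^sup>2"
    using le[of b] ip_residual[OF assms(4), of f] assms(3) by (simp add: b_def c_def)
  ultimately show ?thesis by (simp add: c_def)
qed

section \<open>Rank-one projections and their square roots\<close>

lemma dim_proj_vec [simp]: "proj_vec n \<phi> \<in> carrier_mat n n"
  "dim_row (proj_vec n \<phi>) = n" "dim_col (proj_vec n \<phi>) = n"
  by (simp_all add: proj_vec_def)

lemma index_proj_vec [simp]:
  "i < n \<Longrightarrow> j < n \<Longrightarrow> proj_vec n \<phi> $$ (i, j) = \<phi> $ i * cnj (\<phi> $ j)"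
  by (simp add: proj_vec_def)

lemma unit_vector_ip: "unit_vector n \<phi> \<Longrightarrow> ip n (($) \<phi>) (($) \<phi>) = 1"
  by (simp add: unit_vector_def ip_self)

lemma sesq_proj_vec: "sesq n (proj_vec n \<phi>) f g = ip n f (($) \<phi>) * ip n (($) \<phi>) g"
  unfolding sesq_def ip_def sum_product by (intro sum.cong refl) simp

lemma psd_proj_vec: "psd n (proj_vec n \<phi>)"
  unfolding psd_iff_sesq sesq_proj_vec ip_mult_cnj by simp

lemma psd_one_minus_proj_vec:
  assumes "unit_vector n \<phi>"
  shows "psd n (1\<^sub>m n - proj_vec n \<phi>)"
  unfolding psd_iff_sesq
proof (intro conjI allI)
  fix f
  have *: "sesq n (1\<^sub>m n - proj_vec n \<phi>) f f = ip n f f - of_real ((cmod (ip n (($) \<phi>) f))\<^sup>2)"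
    by (simp add: sesq_one_minus sesq_proj_vec ip_mult_cnj cmod_ip_commute[of n f])
  show "Im (sesq n (1\<^sub>m n - proj_vec n \<phi>) f f) = 0"
    unfolding * by (simp add: ip_self)
  show "0 \<le> Re (sesq n (1\<^sub>m n - proj_vec n \<phi>) f f)"
    unfolding * using ip_Bessel[OF unit_vector_ip[OF assms], of f] by simp
qed (simp add: minus_carrier_mat)

lemma index_mult_mat_sum:
  "A \<in> carrier_mat n m \<Longrightarrow> B \<in> carrier_mat m k \<Longrightarrow> i < n \<Longrightarrow> j < k
    \<Longrightarrow> (A * B) $$ (i, j) = (\<Sum>l<m. A $$ (i, l) * B $$ (l, j))"
  by (auto simp: scalar_prod_def lessThan_atLeast0 intro!: sum.cong)

lemma mtrace_proj_vec_mult: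
  assumes "E \<in> carrier_mat n n"
  shows "mtrace (proj_vec n \<phi> * E) = sesq n E (($) \<phi>) (($) \<phi>)"
proof -
  have "mtrace (proj_vec n \<phi> * E) = (\<Sum>i<n. \<Sum>l<n. \<phi> $ i * cnj (\<phi> $ l) * E $$ (l, i))"
    unfolding mtrace_def using assms
    by (simp add: index_mult_mat_sum[OF dim_proj_vec(1) assms] del: index_mult_mat(1))
  also have "\<dots> = sesq n E (($) \<phi>) (($) \<phi>)"
    unfolding sesq_def by (subst sum.swap) (simp add: mult_ac)
  finally show ?thesis .
qed

lemma proj_vec_idem:
  assumes "unit_vector n \<phi>"
  shows "proj_vec n \<phi> * proj_vec n \<phi> = proj_vec n \<phi>"
proof (rule eq_matI)
  fix i j assume ij: "i < dim_row (proj_vec n \<phi>)" "j < dim_col (proj_vec n \<phi>)"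
  then have "(proj_vec n \<phi> * proj_vec n \<phi>) $$ (i, j)
     = (\<Sum>l<n. \<phi> $ i * cnj (\<phi> $ l) * (\<phi> $ l * cnj (\<phi> $ j)))"
    by (simp add: index_mult_mat_sum[OF dim_proj_vec(1) dim_proj_vec(1)] del: index_mult_mat(1))
  also have "\<dots> = \<phi> $ i * cnj (\<phi> $ j) * ip n (($) \<phi>) (($) \<phi>)"
    by (simp add: ip_def sum_distrib_left mult_ac)
  finally show "(proj_vec n \<phi> * proj_vec n \<phi>) $$ (i, j) = proj_vec n \<phi> $$ (i, j)"
    using ij by (simp add: unit_vector_ip[OF assms])
qed simp_all

text \<open>On the orthogonal complement of \<open>\<phi>\<close> we have \<open>\<parallel>B f\<parallel>\<^sup>2 = \<langle>f, B\<^sup>2 f\<rangle> = 0\<close>, so \<open>B\<close> has rank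
  one and is determined by \<open>B \<phi>\<close>, which positivity forces to be \<open>\<phi>\<close>.\<close>

lemma psd_sqrt_proj_vec_unique:
  assumes unit: "unit_vector n \<phi>" and psd: "psd n B" and sq: "B * B = proj_vec n \<phi>"
  shows "B = proj_vec n \<phi>"
proof -
  define app where "app f i = (\<Sum>j<n. B $$ (i, j) * f j)" for f i
  let ?p = "($) \<phi>"
  have p1: "ip n ?p ?p = 1" by (rule unit_vector_ip[OF unit])
  have B: "B \<in> carrier_mat n n" using psd by (simp add: psd_def)
  have BB: "(\<Sum>k<n. B $$ (i, k) * B $$ (k, j)) = \<phi> $ i * cnj (\<phi> $ j)" if "i < n" "j < n" for i j
    using index_mult_mat_sum[OF B B that] that by (simp add: sq)
  have app_app: "app (app f) i = \<phi> $ i * ip n ?p f" if "i < n" for f i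
  proof -
    have "app (app f) i = (\<Sum>j<n. (\<Sum>k<n. B $$ (i, k) * B $$ (k, j)) * f j)"
      unfolding app_def sum_distrib_left sum_distrib_right
      by (subst sum.swap) (simp add: mult_ac)
    also have "\<dots> = \<phi> $ i * ip n ?p f"
      unfolding ip_def sum_distrib_left using that by (intro sum.cong refl) (simp add: BB)
    finally show ?thesis .
  qed
  have adj: "ip n (app f) g = ip n f (app g)" for f g
  proof -
    have "ip n (app f) g = (\<Sum>i<n. \<Sum>j<n. B $$ (j, i) * cnj (f j) * g i)"
      unfolding ip_def app_def cnj_sum sum_distrib_right
      by (intro sum.cong refl) (simp add: psd_hermitian[OF psd])
    also have "\<dots> = ip n f (app g)"
      unfolding ip_def app_def sum_distrib_left by (subst sum.swap) (simp add: mult_ac)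
    finally show ?thesis .
  qed
  have ker: "app f i = 0" if "ip n ?p f = 0" "i < n" for f i
  proof -
    have "ip n (app f) (app f) = 0"
      unfolding adj ip_def[of n f] using that(1) by (simp add: app_app)
    then have "(\<Sum>i<n. (cmod (app f i))\<^sup>2) = 0"
      unfolding ip_self using of_real_eq_0_iff by blast
    then show ?thesis using that(2) by (simp add: sum_nonneg_eq_0_iff)
  qed
  have rank1: "app f i = ip n ?p f * app ?p i" if "i < n" for f i
  proof -
    have "app (\<lambda>j. f j - ip n ?p f * ?p j) i = 0"
      by (rule ker) (simp_all add: that ip_diff_scale_right p1)
    then show ?thesis
      by (simp add: app_def algebra_simps sum_subtractf sum_distrib_left)
  qed
  define k where "k = ip n ?p (app ?p)"
  \<comment> \<open>The rank-one formula turns \<open>app (app ?p)\<close> into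
    \<open>k * app ?p\<close>, while \<open>B * B\<close> fixes \<open>?p\<close>. Pairing with
    \<open>?p\<close> then gives \<open>k * k = 1\<close>, and positivity of \<open>B\<close>
    excludes \<open>k = -1\<close>.\<close>
  have kp: "k * app ?p i = \<phi> $ i" if "i < n" for i
    using rank1[OF that, of "app ?p"] app_app[OF that, of ?p] by (simp add: k_def p1)
  have "k = sesq n B ?p ?p"
    by (simp add: k_def ip_def app_def sesq_def sum_distrib_left mult_ac)
  then have k0: "Im k = 0" "0 \<le> Re k" using psd by (simp_all add: psd_iff_sesq)
  have "k * k = (\<Sum>i<n. cnj (\<phi> $ i) * (k * app ?p i))"
    by (simp add: k_def ip_def sum_distrib_left mult_ac)
  also have "\<dots> = 1" using p1 by (simp add: kp ip_def)
  finally have "Re k = 1" using k0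
    by (auto simp: complex_eq_iff square_eq_1_iff)
  then have "k = 1" using k0 by (simp add: complex_eq_iff)
  then have app_p: "app ?p i = \<phi> $ i" if "i < n" for i using kp[OF that] by simp
  show ?thesis
  proof (rule eq_matI)
    fix i j assume "i < dim_row (proj_vec n \<phi>)" "j < dim_col (proj_vec n \<phi>)"
    then have ij: "i < n" "j < n" by simp_all
    define e where "e l = (if l = j then 1 else 0 :: complex)" for l
    have "B $$ (i, j) = app e i" using ij by (simp add: app_def e_def if_distrib cong: if_cong)
    also have "\<dots> = ip n ?p e * \<phi> $ i" using rank1[OF ij(1)] app_p[OF ij(1)] by simp
    also have "ip n ?p e = cnj (\<phi> $ j)" using ij by (simp add: ip_def e_def if_distrib cong: if_cong)
    finally show "B $$ (i, j) = proj_vec n \<phi> $$ (i, j)" using ij by simp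
  qed (use B in auto)
qed

lemma mat_sqrt_proj_vec:
  assumes "unit_vector n \<phi>"
  shows "mat_sqrt (proj_vec n \<phi>) = proj_vec n \<phi>"
  unfolding mat_sqrt_def dim_proj_vec
  using psd_proj_vec proj_vec_idem[OF assms] psd_sqrt_proj_vec_unique[OF assms]
  by (intro the_equality) blast+

section \<open>Tensor products and fidelity\<close>

text \<open>The index convention is that of \<open>kron\<close>: the quotient addresses the first
  factor and the remainder the second. Hence the projection onto a product vector is the product of
  the projections.\<close>

definition kron_vec :: "complex vec \<Rightarrow> complex vec \<Rightarrow> complex vec" where
  "kron_vec v w = vec (dim_vec v * dim_vec w) (\<lambda>i. v $ (i div dim_vec w) * w $ (i mod dim_vec w))"

definition tensor_vec :: "('a \<Rightarrow> complex vec) \<Rightarrow> 'a list \<Rightarrow> complex vec" where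
  "tensor_vec \<psi> xs = foldr (\<lambda>x. kron_vec (\<psi> x)) xs (vec 1 (\<lambda>_. 1))"

lemma div_mod_less_mult:
  fixes i m n :: nat
  assumes "i < m * n"
  shows "i div n < m" "i mod n < n"
proof -
  have "n > 0" using assms by (cases n) auto
  then show "i div n < m" "i mod n < n"
    using assms by (simp_all add: less_mult_imp_div_less)
qed

text \<open>Indices below \<open>m * n\<close> correspond to pairs by \<open>i * n + j\<close>; for
  \<open>n = 0\<close> both sides vanish. This is what makes inner products of product vectors
  factorize.\<close>

lemma sum_div_mod:
  fixes f :: "nat \<Rightarrow> nat \<Rightarrow> 'b::comm_monoid_add"
  shows "(\<Sum>i<m * n. f (i div n) (i mod n)) = (\<Sum>i<m. \<Sum>j<n. f i j)"
proof (cases "n = 0")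
  case False
  have "i * n + j < m * n" if "i < m" "j < n" for i j
  proof -
    have "i * n + j < Suc i * n" using that by simp
    also have "\<dots> \<le> m * n" using that by (intro mult_right_mono) auto
    finally show ?thesis .
  qed
  then have "(\<Sum>i<m * n. f (i div n) (i mod n)) = (\<Sum>(i, j)\<in>{..<m} \<times> {..<n}. f i j)"
    by (intro sum.reindex_bij_witness[where i = "\<lambda>(i, j). i * n + j" and j = "\<lambda>i. (i div n, i mod n)"])
      (auto simp: div_mod_less_mult)
  then show ?thesis by (simp add: sum.cartesian_product)
qed simp

lemma kron_vec_carrier:
  "v \<in> carrier_vec m \<Longrightarrow> w \<in> carrier_vec n \<Longrightarrow> kron_vec v w \<in> carrier_vec (m * n)"
  by (auto simp: kron_vec_def)

lemma tensor_vec_Cons: "tensor_vec \<psi> (x # xs) = kron_vec (\<psi> x) (tensor_vec \<psi> xs)"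
  by (simp add: tensor_vec_def)

lemma tensor_vec_carrier:
  "\<forall>x\<in>set xs. \<psi> x \<in> carrier_vec d \<Longrightarrow> tensor_vec \<psi> xs \<in> carrier_vec (d ^ length xs)"
proof (induction xs)
  case Nil
  then show ?case by (simp add: tensor_vec_def)
next
  case (Cons x xs)
  then show ?case by (simp add: tensor_vec_Cons kron_vec_carrier)
qed

lemma kron_proj_vec:
  assumes "v \<in> carrier_vec m" "w \<in> carrier_vec n"
  shows "kron (proj_vec m v) (proj_vec n w) = proj_vec (m * n) (kron_vec v w)"
  by (rule eq_matI) (use assms in \<open>auto simp: kron_def kron_vec_def div_mod_less_mult\<close>)

lemma ip_kron_vec:
  assumes "v \<in> carrier_vec m" "w \<in> carrier_vec n" "v' \<in> carrier_vec m" "w' \<in> carrier_vec n"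
  shows "ip (m * n) (($) (kron_vec v w)) (($) (kron_vec v' w'))
       = ip m (($) v) (($) v') * ip n (($) w) (($) w')"
proof -
  define F where "F i j = cnj (v $ i) * v' $ i * (cnj (w $ j) * w' $ j)" for i j
  have "ip (m * n) (($) (kron_vec v w)) (($) (kron_vec v' w'))
      = (\<Sum>i<m * n. F (i div n) (i mod n))"
    unfolding ip_def F_def using assms by (intro sum.cong refl) (simp add: kron_vec_def mult_ac)
  also have "\<dots> = ip m (($) v) (($) v') * ip n (($) w) (($) w')"
    unfolding sum_div_mod by (simp add: F_def ip_def sum_product)
  finally show ?thesis .
qed

lemma tensor_word_proj_vec:
  assumes "\<forall>x\<in>set xs. \<psi> x \<in> carrier_vec d \<and> W x = proj_vec d (\<psi> x)"
  shows "tensor_word W xs = proj_vec (d ^ length xs) (tensor_vec \<psi> xs)"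
  using assms
proof (induction xs)
  case Nil
  then show ?case by (auto simp: tensor_word_def tensor_vec_def proj_vec_def intro!: eq_matI)
next
  case (Cons x xs)
  then show ?case
    using kron_proj_vec[of "\<psi> x" d "tensor_vec \<psi> xs" "d ^ length xs"]
    by (simp add: tensor_vec_Cons tensor_vec_carrier) (simp add: tensor_word_def)
qed

lemma ip_tensor_vec:
  assumes "length xs = length ys" "\<forall>x\<in>set xs \<union> set ys. \<psi> x \<in> carrier_vec d"
  shows "ip (d ^ length xs) (($) (tensor_vec \<psi> xs)) (($) (tensor_vec \<psi> ys))
       = prod_list (map2 (\<lambda>x y. ip d (($) (\<psi> x)) (($) (\<psi> y))) xs ys)"
  using assms
proof (induction xs ys rule: list_induct2)
  case Nil
  then show ?case by (simp add: tensor_vec_def ip_def)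
next
  case (Cons x xs y ys)
  then show ?case
    using ip_kron_vec[of "\<psi> x" d "tensor_vec \<psi> xs" "d ^ length xs" "\<psi> y" "tensor_vec \<psi> ys"]
      tensor_vec_carrier[of xs \<psi> d] tensor_vec_carrier[of ys \<psi> d]
    by (simp add: tensor_vec_Cons)
qed

lemma unit_vector_iff_ip:
  "unit_vector n v \<longleftrightarrow> v \<in> carrier_vec n \<and> ip n (($) v) (($) v) = 1"
  unfolding unit_vector_def ip_self by (metis of_real_eq_1_iff)

lemma unit_vector_tensor_vec:
  assumes "\<forall>x\<in>set xs. unit_vector d (\<psi> x)"
  shows "unit_vector (d ^ length xs) (tensor_vec \<psi> xs)"
proof -
  have c: "\<forall>x\<in>set xs. \<psi> x \<in> carrier_vec d" using assms by (simp add: unit_vector_def)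
  have "prod_list (map2 (\<lambda>x y. ip d (($) (\<psi> x)) (($) (\<psi> y))) xs xs) = 1"
    using assms by (induction xs) (auto simp: unit_vector_iff_ip)
  then show ?thesis
    using ip_tensor_vec[of xs xs \<psi> d] c by (simp add: unit_vector_iff_ip tensor_vec_carrier)
qed

section \<open>Fidelity and Hilbert-Schmidt distance of pure states\<close>

definition fid :: "nat \<Rightarrow> complex vec \<Rightarrow> complex vec \<Rightarrow> real" where
  "fid n v w = (cmod (ip n (($) v) (($) w)))\<^sup>2"

lemma fid_nonneg [simp]: "0 \<le> fid n v w"
  by (simp add: fid_def)

lemma fid_le_1: "unit_vector n v \<Longrightarrow> unit_vector n w \<Longrightarrow> fid n v w \<le> 1"
  using ip_Bessel[of n "($) v" "($) w"] by (simp add: fid_def unit_vector_iff_ip)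

lemma fid_commute: "fid n v w = fid n w v"
  by (simp add: fid_def cmod_ip_commute[of n "($) v"])

lemma mtrace_proj_vec_proj_vec: "Re (mtrace (proj_vec n v * proj_vec n w)) = fid n v w"
  by (simp add: mtrace_proj_vec_mult sesq_proj_vec ip_mult_cnj fid_def)

lemma fid_tensor_vec:
  assumes "length xs = length ys" "\<forall>x\<in>set xs \<union> set ys. \<psi> x \<in> carrier_vec d"
  shows "fid (d ^ length xs) (tensor_vec \<psi> xs) (tensor_vec \<psi> ys)
       = prod_list (map2 (\<lambda>x y. fid d (\<psi> x) (\<psi> y)) xs ys)"
  unfolding fid_def ip_tensor_vec[OF assms] using assms(1)
  by (induction xs ys rule: list_induct2) (simp_all add: norm_mult power_mult_distrib)

text \<open>Reading a matrix as the family of its entries makes Minkowski's inequality and entrywise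
  estimates for \<open>L2_set\<close> available for \<open>hs_dist\<close>.\<close>

lemma hs_dist_L2_set:
  assumes "A \<in> carrier_mat d d" "B \<in> carrier_mat d d"
  shows "hs_dist A B = L2_set (\<lambda>p. cmod (A $$ p - B $$ p)) ({..<d} \<times> {..<d})"
proof -
  define M where "M = A - B"
  have M: "M \<in> carrier_mat d d" and ind: "i < d \<Longrightarrow> j < d \<Longrightarrow> M $$ (i, j) = A $$ (i, j) - B $$ (i, j)" for i j
    using assms by (auto simp: M_def)
  have aM: "madj M \<in> carrier_mat d d" using M by (auto simp: madj_def)
  have "mtrace (madj M * M) = (\<Sum>i<d. \<Sum>k<d. madj M $$ (i, k) * M $$ (k, i))"
    unfolding mtrace_def using M aM
    by (simp add: index_mult_mat_sum[OF aM M] del: index_mult_mat(1))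
  also have "\<dots> = (\<Sum>i<d. \<Sum>k<d. of_real ((cmod (M $$ (k, i)))\<^sup>2))"
    using M by (intro sum.cong refl) (simp add: madj_def complex_norm_square mult.commute flip: of_real_power)
  finally have "Re (mtrace (madj M * M)) = (\<Sum>k<d. \<Sum>i<d. (cmod (M $$ (k, i)))\<^sup>2)"
    by (subst sum.swap) simp
  also have "\<dots> = (\<Sum>p\<in>{..<d} \<times> {..<d}. (cmod (A $$ p - B $$ p))\<^sup>2)"
    unfolding sum.cartesian_product by (intro sum.cong refl) (auto simp: ind)
  finally show ?thesis
    unfolding hs_dist_def M_def[symmetric] L2_set_def by simp
qed

lemma hs_dist_triangle:
  assumes "A \<in> carrier_mat d d" "B \<in> carrier_mat d d" "C \<in> carrier_mat d d"
  shows "hs_dist A C \<le> hs_dist A B + hs_dist B C"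
proof -
  have "hs_dist A C \<le> L2_set (\<lambda>p. cmod (A $$ p - B $$ p) + cmod (B $$ p - C $$ p)) ({..<d} \<times> {..<d})"
    unfolding hs_dist_L2_set[OF assms(1,3)]
    by (intro L2_set_mono) (auto intro: norm_triangle_ineq4[THEN order_trans] norm_diff_triangle_le)
  also have "\<dots> \<le> hs_dist A B + hs_dist B C"
    unfolding hs_dist_L2_set[OF assms(1,2)] hs_dist_L2_set[OF assms(2,3)]
    by (rule L2_set_triangle_ineq)
  finally show ?thesis .
qed

lemma hs_dist_commute:
  "A \<in> carrier_mat d d \<Longrightarrow> B \<in> carrier_mat d d \<Longrightarrow> hs_dist A B = hs_dist B A"
  by (simp add: hs_dist_L2_set norm_minus_commute)

lemma hs_dist_self: "A \<in> carrier_mat d d \<Longrightarrow> hs_dist A A = 0"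
  by (simp add: hs_dist_L2_set L2_set_def)

lemma hs_dist_proj_vec:
  assumes "unit_vector d v" "unit_vector d w"
  shows "(hs_dist (proj_vec d v) (proj_vec d w))\<^sup>2 = 2 - 2 * fid d v w"
proof -
  \<comment> \<open>Each of the four monomials is a factor in \<open>i\<close> times a factor in
    \<open>j\<close>, once the entries of \<open>v\<close> and \<open>w\<close> are inserted, so
    each double sum splits into a product of two inner products.\<close>
  have *: "of_real ((cmod (a * cnj b - c * cnj e))\<^sup>2)
      = cnj a * a * (cnj b * b) + cnj c * c * (cnj e * e)
        - cnj a * c * (cnj e * b) - cnj c * a * (cnj b * e)" for a b c e :: complex
    unfolding complex_norm_square by (simp add: algebra_simps)
  have "complex_of_real ((hs_dist (proj_vec d v) (proj_vec d w))\<^sup>2)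
      = (\<Sum>i<d. \<Sum>j<d. of_real ((cmod (v $ i * cnj (v $ j) - w $ i * cnj (w $ j)))\<^sup>2))"
    unfolding sum.cartesian_product hs_dist_L2_set[OF dim_proj_vec(1) dim_proj_vec(1)] L2_set_def
    by (auto simp: sum_nonneg intro!: sum.cong)
  also have "\<dots> = ip d (($) v) (($) v) * ip d (($) v) (($) v) + ip d (($) w) (($) w) * ip d (($) w) (($) w)
       - ip d (($) v) (($) w) * ip d (($) w) (($) v) - ip d (($) w) (($) v) * ip d (($) v) (($) w)"
    unfolding * ip_def sum_product sum.distrib sum_subtractf by simp
  also have "\<dots> = of_real (2 - 2 * fid d v w)"
    using assms by (simp add: ip_mult_cnj fid_def unit_vector_iff_ip cmod_ip_commute[of d "($) w"])
  finally show ?thesis using of_real_eq_iff by blast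
qed

section \<open>Packings and Hamming balls\<close>

definition separated :: "real \<Rightarrow> complex mat set \<Rightarrow> bool" where
  "separated \<delta> S \<longleftrightarrow> (\<forall>A\<in>S. \<forall>B\<in>S. A \<noteq> B \<longrightarrow> \<delta> \<le> hs_dist A B)"

text \<open>Rounding all entries to a grid of mesh \<open>1 / M\<close> is injective on a separated set.\<close>

lemma separated_card_bounded:
  assumes F: "\<forall>A\<in>F. A \<in> carrier_mat d d \<and> (\<forall>i<d. \<forall>j<d. cmod (A $$ (i, j)) \<le> 1)"
    and "0 < \<delta>"
  shows "\<exists>K. \<forall>S. S \<subseteq> F \<and> finite S \<and> separated \<delta> S \<longrightarrow> card S \<le> K"
proof -
  define I where "I = {..<d} \<times> {..<d}"
  \<comment> \<open>The mesh is so fine that two matrices in the same grid cell, whose entries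
    differ by at most \<open>2 / M\<close>, are at distance below \<open>\<delta>\<close> even when
    the distance is bounded by the sum over all entries.\<close>
  obtain M :: nat where M: "real (card I) * 2 / \<delta> < real M" using reals_Archimedean2 by blast
  have "0 \<le> real (card I) * 2 / \<delta>" using \<open>0 < \<delta>\<close> by simp
  then have M0: "0 < real M" using M by linarith
  define G where "G A = (\<lambda>p\<in>I. (\<lfloor>Re (A $$ p) * M\<rfloor>, \<lfloor>Im (A $$ p) * M\<rfloor>))" for A :: "complex mat"
  define R where "R = (\<Pi>\<^sub>E p\<in>I. {- int M..int M} \<times> {- int M..int M})"
  have "finite R" by (auto simp: R_def I_def intro: finite_PiE)
  have "card S \<le> card R" if S: "S \<subseteq> F" "finite S" "separated \<delta> S" for S
  proof (rule card_inj_on_le[OF _ _ \<open>finite R\<close>])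
    have fl: "\<lfloor>x * M\<rfloor> \<in> {- int M..int M}" if "\<bar>x\<bar> \<le> 1" for x :: real
    proof -
      have "\<bar>x * M\<bar> \<le> M" using that M0 by (simp add: abs_mult mult_left_le_one_le)
      then show ?thesis by (auto simp: le_floor_iff floor_le_iff abs_le_iff)
    qed
    have "(\<lfloor>Re (A $$ p) * M\<rfloor>, \<lfloor>Im (A $$ p) * M\<rfloor>) \<in> {- int M..int M} \<times> {- int M..int M}"
      if "A \<in> F" "p \<in> I" for A p
    proof -
      have "cmod (A $$ p) \<le> 1" using F that by (auto simp: I_def)
      then have "\<bar>Re (A $$ p)\<bar> \<le> 1" "\<bar>Im (A $$ p)\<bar> \<le> 1"
        using abs_Re_le_cmod abs_Im_le_cmod order_trans by blast+
      then show ?thesis using fl by blast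
    qed
    then show "G ` S \<subseteq> R" using S(1) unfolding G_def R_def by (auto simp: subset_iff)
    show "inj_on G S"
    proof (rule inj_onI, rule ccontr)
      fix A B assume AB: "A \<in> S" "B \<in> S" "G A = G B" "A \<noteq> B"
      have close: "\<bar>x - y\<bar> \<le> 1 / M" if "\<lfloor>x * M\<rfloor> = \<lfloor>y * M\<rfloor>" for x y :: real
      proof -
        have "\<bar>x * M - y * M\<bar> \<le> 1" using that by linarith
        then have "\<bar>x - y\<bar> * M \<le> 1" by (simp add: abs_mult flip: left_diff_distrib)
        then show ?thesis using M0 by (simp add: field_simps)
      qed
      have "cmod (A $$ p - B $$ p) \<le> 2 / M" if "p \<in> I" for p
      proof -
        have "(\<lfloor>Re (A $$ p) * M\<rfloor>, \<lfloor>Im (A $$ p) * M\<rfloor>) = (\<lfloor>Re (B $$ p) * M\<rfloor>, \<lfloor>Im (B $$ p) * M\<rfloor>)"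
          using fun_cong[OF AB(3), of p] that by (simp add: G_def)
        then have "\<bar>Re (A $$ p) - Re (B $$ p)\<bar> \<le> 1 / M" "\<bar>Im (A $$ p) - Im (B $$ p)\<bar> \<le> 1 / M"
          using close by blast+
        then show ?thesis using cmod_le[of "A $$ p - B $$ p"] by simp
      qed
      then have "L2_set (\<lambda>p. cmod (A $$ p - B $$ p)) I \<le> (\<Sum>p\<in>I. 2 / M)"
        by (intro order_trans[OF L2_set_le_sum] sum_mono) auto
      also have "\<dots> < \<delta>" using M M0 \<open>0 < \<delta>\<close> by (simp add: field_simps)
      also have "L2_set (\<lambda>p. cmod (A $$ p - B $$ p)) I = hs_dist A B"
        using AB S(1) F by (subst hs_dist_L2_set[of _ d]) (auto simp: I_def)
      finally show False using AB S(3) by (force simp: separated_def)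
    qed
  qed
  then show ?thesis by blast
qed

text \<open>The cardinalities are bounded, so the supremum is a finite maximum. A maximizing set
  serves as code alphabet in the lower bound and as rounding grid in the upper bound.\<close>

lemma packing_number_attained:
  assumes F: "\<forall>A\<in>F. A \<in> carrier_mat d d \<and> (\<forall>i<d. \<forall>j<d. cmod (A $$ (i, j)) \<le> 1)"
    and "0 < \<delta>"
  obtains S where "S \<subseteq> F" "finite S" "separated \<delta> S" "packing_number F \<delta> = enat (card S)"
    "\<And>T. T \<subseteq> F \<Longrightarrow> finite T \<Longrightarrow> separated \<delta> T \<Longrightarrow> card T \<le> card S"
proof -
  define P where "P = {S. S \<subseteq> F \<and> finite S \<and> separated \<delta> S}"
  obtain K where K: "\<forall>S. S \<in> P \<longrightarrow> card S < Suc K"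
    using separated_card_bounded[OF assms] by (auto simp: P_def less_Suc_eq_le)
  have "{} \<in> P" by (simp add: P_def separated_def)
  then obtain S where S: "S \<in> P" "\<And>T. T \<in> P \<Longrightarrow> card T \<le> card S"
    using ex_has_greatest_nat[of "\<lambda>S. S \<in> P" "{}" card "Suc K"] K by blast
  have "packing_number F \<delta> = Sup ((\<lambda>S. enat (card S)) ` P)"
    unfolding packing_number_def P_def separated_def by (intro arg_cong[where f = Sup]) auto
  also have "\<dots> = enat (card S)"
    using S by (intro antisym SUP_least SUP_upper) auto
  finally show thesis using S by (intro that[of S]) (auto simp: P_def)
qed

text \<open>A point at distance at least \<open>\<delta>\<close> from all of \<open>S\<close> could
  be added to \<open>S\<close>; it would be new, because its distance to itself is 0.\<close>

lemma maximal_separated_covers: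
  assumes "\<forall>A\<in>F. A \<in> carrier_mat d d" "0 < \<delta>" "S \<subseteq> F" "finite S" "separated \<delta> S"
    and max: "\<And>T. T \<subseteq> F \<Longrightarrow> finite T \<Longrightarrow> separated \<delta> T \<Longrightarrow> card T \<le> card S"
    and "A \<in> F"
  shows "\<exists>B\<in>S. hs_dist A B < \<delta>"
proof (rule ccontr)
  assume "\<not> ?thesis"
  then have far: "\<And>B. B \<in> S \<Longrightarrow> \<delta> \<le> hs_dist A B" by force
  then have "A \<notin> S" using hs_dist_self[of A d] assms(1,2,7) by force
  have "separated \<delta> (insert A S)"
    unfolding separated_def
  proof (intro ballI impI)
    fix B C assume "B \<in> insert A S" "C \<in> insert A S" "B \<noteq> C"
    moreover have "hs_dist B A = hs_dist A B" if "B \<in> S" for B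
      using that assms by (intro hs_dist_commute[of _ d]) auto
    ultimately show "\<delta> \<le> hs_dist B C"
      using far \<open>separated \<delta> S\<close> by (auto simp: separated_def)
  qed
  then have "card (insert A S) \<le> card S" using assms by (intro max) auto
  then show False using \<open>A \<notin> S\<close> \<open>finite S\<close> by simp
qed

section \<open>Hamming balls and codes of large minimum distance\<close>

definition hamming :: "'a list \<Rightarrow> 'a list \<Rightarrow> nat" where
  "hamming xs ys = length (filter (\<lambda>(x, y). x \<noteq> y) (zip xs ys))"

lemma hamming_simps [simp]:
  "hamming [] [] = 0"
  "hamming (x # xs) (y # ys) = (if x = y then hamming xs ys else Suc (hamming xs ys))"
  by (simp_all add: hamming_def)

lemma hamming_commute: "length xs = length ys \<Longrightarrow> hamming xs ys = hamming ys xs"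
  by (induction xs ys rule: list_induct2) auto

lemma hamming_self: "hamming xs xs = 0"
  by (induction xs) auto

text \<open>A crude count: \<open>2 ^ length w\<close> bounds the sets of positions where
  disagreement is allowed, and \<open>card A ^ k\<close> the letters there. In the induction the
  first letter either agrees or is arbitrary at the price of one unit of radius.\<close>

lemma card_hamming_ball:
  assumes "finite A" "A \<noteq> {}"
  shows "card {v. set v \<subseteq> A \<and> length v = length w \<and> hamming v w \<le> k} \<le> 2 ^ length w * card A ^ k"
    (is "card (?B w k) \<le> _")
proof (induction w arbitrary: k)
  case Nil
  have "?B [] k = {[]}" by auto
  moreover have "0 < card A" using assms by (simp add: card_gt_0_iff)
  ultimately show ?case by (simp add: Suc_le_eq)
next
  case (Cons x w)
  have fin: "finite (?B w l)" for l
    using finite_lists_length_eq[OF assms(1), of "length w"] by (rule finite_subset[rotated]) auto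
  show ?case
  proof (cases k)
    case 0
    have "v \<in> (#) x ` ?B w 0" if "v \<in> ?B (x # w) 0" for v
      using that by (cases v) (auto split: if_splits)
    then have "card (?B (x # w) 0) \<le> card ((#) x ` ?B w 0)"
      by (intro card_mono finite_imageI fin subsetI)
    also have "\<dots> \<le> card (?B w 0)" using fin by (rule card_image_le)
    also have "\<dots> \<le> 2 ^ length (x # w) * card A ^ 0" using Cons.IH[of 0] by simp
    finally show ?thesis using 0 by simp
  next
    case (Suc l)
    let ?U = "(#) x ` ?B w k" and ?V = "(\<lambda>(a, v). a # v) ` (A \<times> ?B w l)"
    have "v \<in> ?U \<union> ?V" if "v \<in> ?B (x # w) k" for v
      using that Suc by (cases v) (auto split: if_splits)
    then have "card (?B (x # w) k) \<le> card (?U \<union> ?V)"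
      using fin assms by (intro card_mono) auto
    also have "\<dots> \<le> card ?U + card ?V" by (rule card_Un_le)
    also have "\<dots> \<le> card (?B w k) + card (A \<times> ?B w l)"
      using fin assms by (intro add_mono card_image_le) auto
    also have "\<dots> \<le> 2 ^ length w * card A ^ k + card A * (2 ^ length w * card A ^ l)"
      unfolding card_cartesian_product by (intro add_mono mult_left_mono Cons.IH) auto
    also have "\<dots> = 2 ^ length (x # w) * card A ^ k" using Suc by simp
    finally show ?thesis .
  qed
qed

text \<open>Take a code of maximal size with all distances above \<open>k\<close>. A word outside
  all balls of radius \<open>k\<close> around its members could be added, so these balls cover all
  words, and counting gives the last inequality.\<close>

lemma Gilbert_Varshamov:
  assumes "finite A" "A \<noteq> {}"
  obtains C where "finite C" "C \<subseteq> {v. set v \<subseteq> A \<and> length v = n}"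
    "\<And>v w. v \<in> C \<Longrightarrow> w \<in> C \<Longrightarrow> v \<noteq> w \<Longrightarrow> k < hamming v w"
    "card A ^ n \<le> card C * (2 ^ n * card A ^ k)"
proof -
  define L where "L = {v. set v \<subseteq> A \<and> length v = n}"
  define P where "P C \<longleftrightarrow> C \<subseteq> L \<and> (\<forall>v\<in>C. \<forall>w\<in>C. v \<noteq> w \<longrightarrow> k < hamming v w)" for C
  have fL: "finite L" and cL: "card L = card A ^ n"
    using finite_lists_length_eq[OF assms(1), of n] card_lists_length_eq[OF assms(1), of n]
    by (simp_all add: L_def)
  have "P {}" by (simp add: P_def)
  moreover have "\<forall>C. P C \<longrightarrow> card C < Suc (card L)"
    using fL by (auto simp: P_def less_Suc_eq_le intro: card_mono)
  ultimately obtain C where C: "P C" "\<And>D. P D \<Longrightarrow> card D \<le> card C"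
    using ex_has_greatest_nat[of P "{}" card "Suc (card L)"] by blast
  have fC: "finite C" using C(1) fL by (auto simp: P_def intro: finite_subset)
  let ?ball = "\<lambda>w. {v. set v \<subseteq> A \<and> length v = length w \<and> hamming v w \<le> k}"
  have "L \<subseteq> (\<Union>w\<in>C. ?ball w)"
  proof
    fix v assume v: "v \<in> L"
    show "v \<in> (\<Union>w\<in>C. ?ball w)"
    proof (rule ccontr)
      assume "v \<notin> (\<Union>w\<in>C. ?ball w)"
      then have far: "k < hamming v w \<and> k < hamming w v" if "w \<in> C" for w
        using that v C(1) hamming_commute[of v w] by (force simp: P_def L_def)
      then have "v \<notin> C" using hamming_self[of v] by force
      moreover have "P (insert v C)"
        using C(1) v far unfolding P_def by auto
      then have "card (insert v C) \<le> card C" by (rule C(2))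
      ultimately show False using fC by simp
    qed
  qed
  moreover have fin: "finite (?ball w)" for w
    using finite_lists_length_eq[OF assms(1), of "length w"] by (rule finite_subset[rotated]) auto
  ultimately have "card L \<le> card (\<Union>w\<in>C. ?ball w)"
    using fC by (intro card_mono) auto
  also have "\<dots> \<le> (\<Sum>w\<in>C. card (?ball w))" using fC by (rule card_UN_le)
  also have "\<dots> \<le> (\<Sum>w\<in>C. 2 ^ n * card A ^ k)"
  proof (rule sum_mono)
    fix w assume "w \<in> C"
    then have "length w = n" using C(1) by (auto simp: P_def L_def)
    then show "card (?ball w) \<le> 2 ^ n * card A ^ k"
      using card_hamming_ball[OF assms, of w k] by simp
  qed
  finally have "card A ^ n \<le> card C * (2 ^ n * card A ^ k)" by (simp add: cL)
  then show thesis using C(1) fC by (intro that[of C]) (auto simp: P_def L_def)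
qed

section \<open>Codes for pure-state channels\<close>

text \<open>Since the product of the remaining factors is at most 1, one more factor
  \<open>r\<close> lowers it by at most \<open>1 - r\<close>. The induction therefore carries the
  bounds 0 and 1 along.\<close>

lemma prod_list_ge_1_minus_sum:
  assumes "\<forall>r\<in>set rs. 0 \<le> r \<and> r \<le> 1 \<and> 1 - e \<le> r"
  shows "1 - real (length rs) * e \<le> prod_list rs"
proof -
  have "0 \<le> prod_list rs \<and> prod_list rs \<le> 1 \<and> 1 - real (length rs) * e \<le> prod_list rs"
    using assms
  proof (induction rs)
    case (Cons r rs)
    then have IH: "0 \<le> prod_list rs" "prod_list rs \<le> 1" "1 - real (length rs) * e \<le> prod_list rs"
      and r: "0 \<le> r" "r \<le> 1" "1 - e \<le> r" by auto
    have "(1 - r) * prod_list rs \<le> 1 - r" using r IH by (simp add: mult_left_le)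
    moreover have "r * prod_list rs \<le> 1" using r IH by (simp add: mult_le_one)
    ultimately show ?case using r IH by (simp add: algebra_simps)
  qed simp
  then show ?thesis by blast
qed

lemma prod_list_hamming_le:
  fixes f :: "'a \<Rightarrow> 'a \<Rightarrow> real"
  assumes "length xs = length ys"
    and "\<forall>x\<in>set xs. \<forall>y\<in>set ys. 0 \<le> f x y \<and> f x y \<le> 1 \<and> (x \<noteq> y \<longrightarrow> f x y \<le> b)" "0 \<le> b"
  shows "prod_list (map2 f xs ys) \<le> b ^ hamming xs ys"
  using assms
proof (induction xs ys rule: list_induct2)
  case (Cons x xs y ys)
  then have IH: "prod_list (map2 f xs ys) \<le> b ^ hamming xs ys" by simp
  have nn: "0 \<le> prod_list (map2 f xs ys)"
    using Cons.prems by (intro prod_list_nonneg) (auto dest: set_zip_leftD set_zip_rightD)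
  show ?case
  proof (cases "x = y")
    case True
    have "f x y * prod_list (map2 f xs ys) \<le> 1 * b ^ hamming xs ys"
      using IH nn Cons.prems by (intro mult_mono) auto
    then show ?thesis using True by simp
  next
    case False
    have "f x y * prod_list (map2 f xs ys) \<le> b * b ^ hamming xs ys"
      using IH nn Cons.prems False by (intro mult_mono) auto
    then show ?thesis using False by simp
  qed
qed simp

section \<open>Words over a pure-state channel, with one state vector fixed per input\<close>

locale pure_channel =
  fixes d :: nat and X :: "'a set" and W :: "'a \<Rightarrow> complex mat" and \<psi> :: "'a \<Rightarrow> complex vec"
  assumes unit: "x \<in> X \<Longrightarrow> unit_vector d (\<psi> x)"
    and W_eq: "x \<in> X \<Longrightarrow> W x = proj_vec d (\<psi> x)"
begin

lemma carrier_psi: "x \<in> X \<Longrightarrow> \<psi> x \<in> carrier_vec d"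
  using unit by (simp add: unit_vector_def)

lemma tensor_word_eq:
  "set xs \<subseteq> X \<Longrightarrow> tensor_word W xs = proj_vec (d ^ length xs) (tensor_vec \<psi> xs)"
  by (rule tensor_word_proj_vec) (auto simp: carrier_psi W_eq)

lemma unit_word: "set xs \<subseteq> X \<Longrightarrow> unit_vector (d ^ length xs) (tensor_vec \<psi> xs)"
  by (rule unit_vector_tensor_vec) (auto simp: unit)

lemma fid_word:
  "set xs \<subseteq> X \<Longrightarrow> set ys \<subseteq> X \<Longrightarrow> length xs = length ys \<Longrightarrow>
    fid (d ^ length xs) (tensor_vec \<psi> xs) (tensor_vec \<psi> ys)
      = prod_list (map2 (\<lambda>x y. fid d (\<psi> x) (\<psi> y)) xs ys)"
  by (rule fid_tensor_vec) (auto simp: carrier_psi)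

lemma hs_dist_W:
  "x \<in> X \<Longrightarrow> y \<in> X \<Longrightarrow> (hs_dist (W x) (W y))\<^sup>2 = 2 - 2 * fid d (\<psi> x) (\<psi> y)"
  by (simp add: W_eq hs_dist_proj_vec unit)

lemma outputs_bounded:
  "\<forall>A\<in>W ` X. A \<in> carrier_mat d d \<and> (\<forall>i<d. \<forall>j<d. cmod (A $$ (i, j)) \<le> 1)"
proof -
  have "cmod (\<psi> x $ i) \<le> 1" if "x \<in> X" "i < d" for x i
  proof -
    have "(cmod (\<psi> x $ i))\<^sup>2 \<le> (\<Sum>i<d. (cmod (\<psi> x $ i))\<^sup>2)"
      using that by (intro member_le_sum) auto
    then show ?thesis using unit[OF that(1)] by (simp add: unit_vector_def power_le_one_iff abs_square_le_1)
  qed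
  then show ?thesis by (auto simp: W_eq norm_mult mult_le_one)
qed

text \<open>Each word is tested by its own projection: it is accepted with certainty, and the second
  error is the fidelity of two words.\<close>

lemma code_of_words:
  assumes C: "finite C" "C \<subseteq> {v. set v \<subseteq> X \<and> length v = n}"
    and fid: "\<And>v w. v \<in> C \<Longrightarrow> w \<in> C \<Longrightarrow> v \<noteq> w
      \<Longrightarrow> prod_list (map2 (\<lambda>x y. fid d (\<psi> x) (\<psi> y)) v w) \<le> l2"
    and "0 < l1"
  shows "enat (card C) \<le> N_DI d X W n l1 l2"
proof -
  obtain h where h: "bij_betw h {..<card C} C"
    using ex_bij_betw_nat_finite[OF C(1)] by (auto simp: lessThan_atLeast0)
  have hC: "set (h j) \<subseteq> X" "length (h j) = n" "h j \<in> C" if "j < card C" for j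
    using bij_betwE[OF h] that C(2) by blast+
  have "DI_code d X W n (card C) l1 l2 h (\<lambda>j. tensor_word W (h j))"
    unfolding DI_code_def
  proof (intro allI impI conjI)
    fix j assume j: "j < card C"
    note hj = hC[OF j]
    have eq: "tensor_word W (h j) = proj_vec (d ^ n) (tensor_vec \<psi> (h j))"
      and u: "unit_vector (d ^ n) (tensor_vec \<psi> (h j))"
      using tensor_word_eq[of "h j"] unit_word[of "h j"] hj by simp_all
    show "length (h j) = n" "set (h j) \<subseteq> X" using hj by simp_all
    show "psd (d ^ n) (tensor_word W (h j))" unfolding eq by (rule psd_proj_vec)
    show "psd (d ^ n) (1\<^sub>m (d ^ n) - tensor_word W (h j))"
      unfolding eq using u by (rule psd_one_minus_proj_vec)
    show "1 - l1 \<le> Re (mtrace (tensor_word W (h j) * tensor_word W (h j)))"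
      unfolding eq mtrace_proj_vec_proj_vec using u \<open>0 < l1\<close>
      by (simp add: fid_def unit_vector_iff_ip)
    fix k assume k: "k < card C" "k \<noteq> j"
    note hk = hC[OF k(1)]
    have "h j \<noteq> h k" using h j k by (auto simp: bij_betw_def inj_on_def)
    then show "Re (mtrace (tensor_word W (h j) * tensor_word W (h k))) \<le> l2"
      using fid[of "h j" "h k"] fid_word[of "h j" "h k"] tensor_word_eq[of "h k"] hj hk
      by (simp add: eq mtrace_proj_vec_proj_vec)
  qed
  then show ?thesis unfolding N_DI_def by (intro Sup_upper) blast
qed

text \<open>Distinct words of a Gilbert--Varshamov code differ in more than \<open>k\<close> places,
  and each such place contributes a factor at most \<open>1 - \<delta>\<^sup>2 / 2\<close>; the
  bound \<open>\<delta> \<le> 1\<close> keeps this base nonnegative.\<close>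

lemma N_DI_lower:
  assumes S: "S \<subseteq> W ` X" "finite S" "S \<noteq> {}" "separated \<delta> S"
    and "0 < \<delta>" "\<delta> \<le> 1" "0 < l1" "(1 - \<delta>\<^sup>2 / 2) ^ k \<le> l2"
  obtains N where "enat N \<le> N_DI d X W n l1 l2" "card S ^ n \<le> N * (2 ^ n * card S ^ k)"
proof -
  define b where "b = 1 - \<delta>\<^sup>2 / 2"
  have "\<delta>\<^sup>2 \<le> 1" using assms by (simp add: power_le_one)
  then have b: "0 \<le> b" "b \<le> 1" by (simp_all add: b_def)
  \<comment> \<open>One input is chosen for each output in \<open>S\<close>, so that distinct
    letters have separated outputs.\<close>
  obtain A where A: "A \<subseteq> X" "inj_on W A" "S = W ` A"
    using S(1) by (meson subset_image_inj)
  have cA: "card A = card S" and "finite A" "A \<noteq> {}"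
    using A S finite_image_iff[OF A(2)] by (auto simp: card_image)
  obtain C where C: "finite C" "C \<subseteq> {v. set v \<subseteq> A \<and> length v = n}"
    "\<And>v w. v \<in> C \<Longrightarrow> w \<in> C \<Longrightarrow> v \<noteq> w \<Longrightarrow> k < hamming v w"
    "card A ^ n \<le> card C * (2 ^ n * card A ^ k)"
    by (rule Gilbert_Varshamov[OF \<open>finite A\<close> \<open>A \<noteq> {}\<close>, where n = n and k = k]) blast
  have fA: "fid d (\<psi> x) (\<psi> y) \<le> b" if "x \<in> A" "y \<in> A" "x \<noteq> y" for x y
  proof -
    have "W x \<noteq> W y" using that A(2) by (auto simp: inj_on_def)
    then have "\<delta> \<le> hs_dist (W x) (W y)" using that A(3) S(4) by (auto simp: separated_def)
    then have "\<delta>\<^sup>2 \<le> (hs_dist (W x) (W y))\<^sup>2" using \<open>0 < \<delta>\<close> by (simp add: power_mono)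
    moreover have "x \<in> X" "y \<in> X" using that A(1) by auto
    ultimately show ?thesis using hs_dist_W[of x y] by (simp add: b_def)
  qed
  have "enat (card C) \<le> N_DI d X W n l1 l2"
  proof (rule code_of_words)
    show "C \<subseteq> {v. set v \<subseteq> X \<and> length v = n}" using C(2) A(1) by blast
    fix v w assume vw: "v \<in> C" "w \<in> C" "v \<noteq> w"
    then have sub: "set v \<subseteq> A" "set w \<subseteq> A" "length v = length w" using C(2) by auto
    have "prod_list (map2 (\<lambda>x y. fid d (\<psi> x) (\<psi> y)) v w) \<le> b ^ hamming v w"
      using sub A(1) fA b fid_le_1 unit by (intro prod_list_hamming_le) (auto simp: subset_iff)
    also have "\<dots> \<le> b ^ k" using b C(3)[OF vw] by (intro power_decreasing) auto
    finally show "prod_list (map2 (\<lambda>x y. fid d (\<psi> x) (\<psi> y)) v w) \<le> l2"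
      using assms(8) by (simp add: b_def)
  qed (use C assms in auto)
  then show thesis using C(4) that by (simp add: cA)
qed

text \<open>The effect \<open>E j\<close> must accept word \<open>j\<close> and reject word
  \<open>k\<close>, and \<open>effect_pure_bound\<close> limits how well it can do so when the two
  states are close.\<close>

lemma DI_code_fid:
  assumes "DI_code d X W n N l1 l2 u E" "j < N" "k < N" "j \<noteq> k"
  shows "1 - l1 \<le> 2 * l2 + 2 * (1 - prod_list (map2 (\<lambda>x y. fid d (\<psi> x) (\<psi> y)) (u j) (u k)))"
proof -
  let ?v = "\<lambda>j. tensor_vec \<psi> (u j)"
  note code = assms(1)[unfolded DI_code_def, rule_format]
  have w: "set (u i) \<subseteq> X" "length (u i) = n" if "i < N" for i using code[OF that] by auto
  have t: "tensor_word W (u i) = proj_vec (d ^ n) (?v i)" and un: "unit_vector (d ^ n) (?v i)"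
    if "i < N" for i
    using tensor_word_eq[of "u i"] unit_word[of "u i"] w[OF that] by simp_all
  have psd: "psd (d ^ n) (E j)" "psd (d ^ n) (1\<^sub>m (d ^ n) - E j)" using code[OF assms(2)] by auto
  then have E: "E j \<in> carrier_mat (d ^ n) (d ^ n)" by (simp add: psd_def)
  have "1 - l1 \<le> Re (sesq (d ^ n) (E j) (($) (?v j)) (($) (?v j)))"
    using code[OF assms(2)] by (simp add: t[OF assms(2)] mtrace_proj_vec_mult[OF E])
  also have "\<dots> \<le> 2 * Re (sesq (d ^ n) (E j) (($) (?v k)) (($) (?v k)))
      + 2 * (1 - fid (d ^ n) (?v k) (?v j))"
    unfolding fid_def using un assms by (intro effect_pure_bound psd) (auto simp: unit_vector_iff_ip)
  also have "Re (sesq (d ^ n) (E j) (($) (?v k)) (($) (?v k))) \<le> l2"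
  proof -
    have "Re (mtrace (tensor_word W (u k) * E j)) \<le> l2" using code[OF assms(3)] assms by blast
    then show ?thesis by (simp add: t[OF assms(3)] mtrace_proj_vec_mult[OF E])
  qed
  also have "fid (d ^ n) (?v k) (?v j) = prod_list (map2 (\<lambda>x y. fid d (\<psi> x) (\<psi> y)) (u j) (u k))"
    using fid_word[of "u j" "u k"] w assms by (simp add: fid_commute[of _ "?v k"])
  finally show ?thesis by simp
qed

text \<open>A maximal packing covers the outputs, so each letter can be rounded to a packing point
  \<open>c x\<close>. Two codewords with equal roundings would be too similar for the errors
  \<open>1 / 4\<close>.\<close>

lemma N_DI_upper:
  assumes "0 < \<delta>" "16 * real n * \<delta>\<^sup>2 < 1" "packing_number (W ` X) \<delta> = enat m"
  shows "N_DI d X W n (1 / 4) (1 / 4) \<le> enat (m ^ n)"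
proof -
  obtain S where S: "S \<subseteq> W ` X" "finite S" "separated \<delta> S" "packing_number (W ` X) \<delta> = enat (card S)"
    "\<And>T. T \<subseteq> W ` X \<Longrightarrow> finite T \<Longrightarrow> separated \<delta> T \<Longrightarrow> card T \<le> card S"
    by (rule packing_number_attained[OF outputs_bounded assms(1)]) blast
  have m: "m = card S" using S(4) assms(3) by simp
  have cm: "\<forall>A\<in>W ` X. A \<in> carrier_mat d d" using outputs_bounded by blast
  have "\<forall>x\<in>X. \<exists>B\<in>S. hs_dist (W x) B < \<delta>"
    using maximal_separated_covers[OF cm assms(1) S(1,2,3,5)] by blast
  then obtain c where c: "\<And>x. x \<in> X \<Longrightarrow> c x \<in> S \<and> hs_dist (W x) (c x) < \<delta>" by metis
  have close: "1 - 2 * \<delta>\<^sup>2 \<le> fid d (\<psi> x) (\<psi> y)" if "x \<in> X" "y \<in> X" "c x = c y" for x y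
  proof -
    have car: "W x \<in> carrier_mat d d" "W y \<in> carrier_mat d d" "c x \<in> carrier_mat d d"
      using that(1,2) c S(1) cm by blast+
    have "hs_dist (W x) (W y) \<le> hs_dist (W x) (c x) + hs_dist (c x) (W y)"
      by (rule hs_dist_triangle[OF car(1,3,2)])
    also have "hs_dist (c x) (W y) = hs_dist (W y) (c y)"
      using hs_dist_commute[OF car(3,2)] that(3) by simp
    finally have "hs_dist (W x) (W y) \<le> 2 * \<delta>" using c[OF that(1)] c[OF that(2)] by linarith
    moreover have "0 \<le> hs_dist (W x) (W y)"
      using that cm by (simp add: hs_dist_L2_set[of _ d])
    ultimately have "(hs_dist (W x) (W y))\<^sup>2 \<le> (2 * \<delta>)\<^sup>2" by (intro power_mono)
    then show ?thesis using hs_dist_W[of x y] that by (simp add: power_mult_distrib)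
  qed
  have "N \<le> m ^ n" if code: "DI_code d X W n N (1 / 4) (1 / 4) u E" for N u E
  proof -
    have w: "set (u j) \<subseteq> X" "length (u j) = n" if "j < N" for j
      using code that by (auto simp: DI_code_def)
    let ?L = "{v. set v \<subseteq> S \<and> length v = n}"
    have "inj_on (\<lambda>j. map c (u j)) {..<N}"
    proof (rule inj_onI, rule ccontr)
      fix j k assume "j \<in> {..<N}" "k \<in> {..<N}" and eq: "map c (u j) = map c (u k)" and ne: "j \<noteq> k"
      then have jk: "j < N" "k < N" by auto
      let ?F = "map2 (\<lambda>x y. fid d (\<psi> x) (\<psi> y)) (u j) (u k)"
      have "c x = c y \<and> x \<in> X \<and> y \<in> X" if xy: "(x, y) \<in> set (zip (u j) (u k))" for x y
      proof -
        have "x \<in> X" "y \<in> X"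
          using set_zip_leftD[OF xy] set_zip_rightD[OF xy] w jk by blast+
        moreover obtain i where "i < n" "x = u j ! i" "y = u k ! i"
          using xy w jk by (auto simp: set_zip)
        then have "c x = map c (u j) ! i" "c y = map c (u k) ! i" using w jk by auto
        ultimately show ?thesis using eq by simp
      qed
      then have "1 - real (length ?F) * (2 * \<delta>\<^sup>2) \<le> prod_list ?F"
        by (intro prod_list_ge_1_minus_sum) (auto intro!: close fid_le_1 unit)
      moreover have "length ?F = n" using w jk by simp
      \<comment> \<open>The code property forces one minus the fidelity to be at least
        \<open>1 / 8\<close>, whereas equal roundings bound it by
        \<open>2 * n * \<delta>\<^sup>2\<close>. This is the origin of the constant 16 in the
        hypothesis.\<close>
      ultimately show False
        using DI_code_fid[OF code jk ne] assms(2) by (simp add: algebra_simps)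
    qed
    moreover have "(\<lambda>j. map c (u j)) ` {..<N} \<subseteq> ?L"
      using w c by fastforce
    ultimately have "card {..<N} \<le> card ?L"
      using finite_lists_length_eq[OF S(2)] by (rule card_inj_on_le)
    then show ?thesis using card_lists_length_eq[OF S(2)] m by simp
  qed
  then show ?thesis unfolding N_DI_def by (intro Sup_least) auto
qed

end

section \<open>Asymptotics\<close>

lemma elog2_mono:
  assumes "a \<le> b"
  shows "elog2 a \<le> elog2 b"
proof (cases b)
  case (enat n)
  then obtain k where k: "a = enat k" "k \<le> n" using assms by (cases a) auto
  show ?thesis
  proof (cases "k = 0")
    \<comment> \<open>Here \<open>log 2 0\<close> has the value 0, and the logarithm of every
      natural number is nonnegative.\<close>
    case True
    have "0 \<le> log 2 (real n)" by (cases "n = 0") (auto simp: log_def)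
    then show ?thesis using True k enat by (simp add: elog2_def log_def)
  next
    case False
    then show ?thesis using k enat by (simp add: elog2_def)
  qed
qed (simp add: elog2_def)

lemma elog2_enat: "elog2 (enat n) = ereal (log 2 (real n))"
  by (simp add: elog2_def)

lemma elog2_ratio_nonneg: "0 \<le> elog2 N / ereal (real n * log 2 (real n))"
proof -
  have e: "0 \<le> elog2 N" using elog2_mono[of "enat 0" N] unfolding elog2_enat
    by (simp add: log_def zero_ereal_def flip: zero_enat_def)
  have "0 \<le> real n * log 2 (real n)" by (cases "n = 0") auto
  then show ?thesis by (intro zero_le_divide_ereal e) simp
qed

text \<open>Density of the reals allows testing at finite levels only, so infinite capacities or
  dimensions need no arithmetic of their own.\<close>

lemma ereal_le_via_reals:
  fixes A B :: ereal
  assumes "\<And>c. ereal c < A \<Longrightarrow> ereal c \<le> B"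
  shows "A \<le> B"
proof (rule ccontr)
  assume "\<not> A \<le> B"
  then have "B < A" by simp
  then obtain c where "B < ereal c" "ereal c < A" using ereal_dense2 by blast
  then show False using assms[of c] by simp
qed

text \<open>Monotonicity in \<open>\<delta>\<close> lets the sequence \<open>\<delta>\<^sub>n = 1 / (5 \<surd>n)\<close> stand in for the continuous
  parameter: \<open>n = \<lfloor>1 / (25 \<delta>\<^sup>2)\<rfloor>\<close> is the largest \<open>n\<close> with \<open>\<delta> \<le> \<delta>\<^sub>n\<close>.\<close>

lemma Liminf_at_right_ge_of_sequence:
  fixes p :: "real \<Rightarrow> real"
  assumes nonneg: "\<And>\<delta>. 0 < \<delta> \<Longrightarrow> 0 \<le> p \<delta>"
    and anti: "\<And>\<delta> \<epsilon>. 0 < \<delta> \<Longrightarrow> \<delta> \<le> \<epsilon> \<Longrightarrow> p \<epsilon> \<le> p \<delta>"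
    and c: "ereal c < liminf (\<lambda>n. ereal (p (1 / (5 * sqrt (real n))) / log 2 (real n)))"
  shows "ereal (2 * c) \<le> Liminf (at_right 0) (\<lambda>\<delta>. ereal (p \<delta> / (- log 2 \<delta>)))"
proof (cases "c \<le> 0")
  case True
  have "eventually (\<lambda>\<delta>::real. \<delta> \<in> {0<..<1}) (at_right 0)"
    by (rule eventually_at_right_real) simp
  then have "eventually (\<lambda>\<delta>. ereal (2 * c) \<le> ereal (p \<delta> / (- log 2 \<delta>))) (at_right 0)"
  proof eventually_elim
    case (elim \<delta>)
    then have "0 \<le> p \<delta> / (- log 2 \<delta>)" using nonneg[of \<delta>] by (intro divide_nonneg_nonneg) auto
    then show ?case using True by simp
  qed
  then show ?thesis by (rule Liminf_bounded)
next
  case False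
  have "eventually (\<lambda>n. c < p (1 / (5 * sqrt (real n))) / log 2 (real n)) sequentially"
    using less_LiminfD[OF c] by simp
  then obtain n0 where n0: "\<And>n. n \<ge> n0 \<Longrightarrow> c < p (1 / (5 * sqrt (real n))) / log 2 (real n)"
    by (auto simp: eventually_sequentially)
  \<comment> \<open>The margin 3 ensures that \<open>n\<close>, after rounding down, is still at
    least \<open>n0\<close> and larger than 2.\<close>
  have ev: "eventually (\<lambda>\<delta>::real. real n0 + 3 < 1 / (25 * \<delta>\<^sup>2)) (at_right 0)"
    by real_asymp
  have ev2: "eventually (\<lambda>\<delta>::real. \<delta> \<in> {0<..<1}) (at_right 0)"
    by (rule eventually_at_right_real) simp
  \<comment> \<open>The factor 2 arises because \<open>n\<close> is of the order of the inverse
    square of \<open>\<delta>\<close>; the \<open>- 1\<close> accounts for the rounding of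
    \<open>n\<close>.\<close>
  have "((\<lambda>\<delta>. c * log 2 (1 / (25 * \<delta>\<^sup>2) - 1) / (- log 2 \<delta>)) \<longlongrightarrow> 2 * c) (at_right 0)"
    by real_asymp
  then have L: "Liminf (at_right 0) (\<lambda>\<delta>. ereal (c * log 2 (1 / (25 * \<delta>\<^sup>2) - 1) / (- log 2 \<delta>))) = ereal (2 * c)"
    by (intro lim_imp_Liminf) auto
  have "eventually (\<lambda>\<delta>. ereal (c * log 2 (1 / (25 * \<delta>\<^sup>2) - 1) / (- log 2 \<delta>))
      \<le> ereal (p \<delta> / (- log 2 \<delta>))) (at_right 0)"
    using ev ev2
  proof eventually_elim
    case (elim \<delta>)
    define n where "n = nat \<lfloor>1 / (25 * \<delta>\<^sup>2)\<rfloor>"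
    have n: "real n \<le> 1 / (25 * \<delta>\<^sup>2)" "1 / (25 * \<delta>\<^sup>2) - 1 < real n"
      using elim unfolding n_def by linarith+
    then have n3: "n0 \<le> n" "2 < real n" using elim by linarith+
    have "real n * (25 * \<delta>\<^sup>2) \<le> 1" using n(1) elim by (simp add: field_simps)
    then have "(5 * \<delta> * sqrt (real n))\<^sup>2 \<le> 1\<^sup>2" by (simp add: power_mult_distrib mult_ac)
    then have "5 * \<delta> * sqrt (real n) \<le> 1" by (rule power2_le_imp_le) simp
    then have "\<delta> \<le> 1 / (5 * sqrt (real n))" using n3 by (simp add: field_simps)
    then have "p (1 / (5 * sqrt (real n))) \<le> p \<delta>" using elim by (intro anti) auto
    moreover have "c * log 2 (real n) < p (1 / (5 * sqrt (real n)))"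
      using n0[OF n3(1)] n3 by (simp add: pos_less_divide_eq)
    moreover have "c * log 2 (1 / (25 * \<delta>\<^sup>2) - 1) \<le> c * log 2 (real n)"
    proof (rule mult_left_mono)
      show "log 2 (1 / (25 * \<delta>\<^sup>2) - 1) \<le> log 2 (real n)"
        using n elim by (intro log_mono) linarith+
    qed (use False in simp)
    ultimately have "c * log 2 (1 / (25 * \<delta>\<^sup>2) - 1) \<le> p \<delta>" by linarith
    moreover have "0 \<le> - log 2 \<delta>" using elim by simp
    ultimately have "c * log 2 (1 / (25 * \<delta>\<^sup>2) - 1) / (- log 2 \<delta>) \<le> p \<delta> / (- log 2 \<delta>)"
      by (rule divide_right_mono)
    then show ?case by simp
  qed
  from Liminf_mono[OF this] show ?thesis unfolding L .
qed

lemma packing_number_antimono: "\<delta> \<le> \<epsilon> \<Longrightarrow> packing_number F \<epsilon> \<le> packing_number F \<delta>"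
  unfolding packing_number_def by (intro Sup_subset_mono) (blast intro: order_trans)

text \<open>The logarithm of the Gilbert--Varshamov count: radius \<open>k\<close> costs
  \<open>k * log 2 q\<close>, and the choice of positions costs \<open>n\<close>.\<close>

lemma log_code_size_ge:
  fixes q N n k :: nat
  assumes "0 < q" "q ^ n \<le> N * (2 ^ n * q ^ k)"
  shows "(real n - real k) * log 2 q - n \<le> log 2 N"
proof -
  have "0 < N" using assms by (cases N) auto
  have "real (q ^ n) \<le> real (N * (2 ^ n * q ^ k))" using assms(2) by (simp only: of_nat_le_iff)
  then have "log 2 (real q ^ n) \<le> log 2 (real N * (2 ^ n * real q ^ k))"
    using assms(1) \<open>0 < N\<close> by simp
  also have "\<dots> = log 2 N + (n + k * log 2 q)"
    using assms(1) \<open>0 < N\<close> by (simp add: log_mult log_nat_power)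
  finally show ?thesis
    using assms(1) by (simp add: log_nat_power algebra_simps)
qed

section \<open>Comparison of the capacity with the Minkowski dimension of the outputs\<close>

context pure_channel
begin

text \<open>A real-valued logarithm, faithful for positive \<open>\<delta>\<close> because the
  packing number is finite there.\<close>

abbreviation pack :: "real \<Rightarrow> real" where
  "pack \<delta> \<equiv> log 2 (real (the_enat (packing_number (W ` X) \<delta>)))"

lemma packing_number_enat:
  assumes "0 < \<delta>"
  shows "packing_number (W ` X) \<delta> = enat (the_enat (packing_number (W ` X) \<delta>))"
  by (rule packing_number_attained[OF outputs_bounded assms]) simp

lemma pack_pos:
  assumes "X \<noteq> {}" "0 < \<delta>"
  shows "0 < the_enat (packing_number (W ` X) \<delta>)"
proof -
  obtain x where "x \<in> X" using assms by blast
  then have "enat (card {W x}) \<le> packing_number (W ` X) \<delta>"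
    unfolding packing_number_def by (intro Sup_upper) (auto intro!: exI[of _ "{W x}"])
  then show ?thesis using packing_number_enat[OF assms(2)]
    by (metis One_nat_def Suc_le_eq card_1_singleton_iff enat_ord_simps(1))
qed

lemma pack_nonneg: "X \<noteq> {} \<Longrightarrow> 0 < \<delta> \<Longrightarrow> 0 \<le> pack \<delta>"
  using pack_pos[of \<delta>] by simp

lemma pack_antimono:
  assumes "X \<noteq> {}" "0 < \<delta>" "\<delta> \<le> \<epsilon>"
  shows "pack \<epsilon> \<le> pack \<delta>"
proof -
  have "0 < \<epsilon>" using assms by simp
  have "the_enat (packing_number (W ` X) \<epsilon>) \<le> the_enat (packing_number (W ` X) \<delta>)"
    using packing_number_antimono[OF assms(3), of "W ` X"]
      packing_number_enat[OF assms(2)] packing_number_enat[OF \<open>0 < \<epsilon>\<close>]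
    by (metis enat_ord_simps(1))
  then show ?thesis
    using pack_pos[OF assms(1,2)] pack_pos[OF assms(1) \<open>0 < \<epsilon>\<close>] by simp
qed

lemma lower_minkowski_dim_eq:
  "lower_minkowski_dim (W ` X) = Liminf (at_right 0) (\<lambda>\<delta>. ereal (pack \<delta> / (- log 2 \<delta>)))"
  unfolding lower_minkowski_dim_def
proof (rule Liminf_eq)
  have "eventually (\<lambda>\<delta>::real. \<delta> \<in> {0<..<1}) (at_right 0)"
    by (rule eventually_at_right_real) simp
  then show "eventually (\<lambda>\<delta>. elog2 (packing_number (W ` X) \<delta>) / ereal (- log 2 \<delta>)
      = ereal (pack \<delta> / (- log 2 \<delta>))) (at_right 0)"
  proof eventually_elim
    case (elim \<delta>)
    then have "log 2 \<delta> < 0" by simp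
    then have "log 2 \<delta> \<noteq> 0" by linarith
    then have "ereal (pack \<delta>) / ereal (- log 2 \<delta>) = ereal (pack \<delta> / (- log 2 \<delta>))"
      by (simp only: ereal_divide neg_equal_0_iff_equal if_False)
    then show ?case
      using elim by (subst packing_number_enat) (simp_all add: elog2_enat)
  qed
qed

text \<open>The infimum is at most its value at errors \<open>1 / 4\<close>. There the rate is at
  most \<open>log 2 m / log 2 n\<close> with \<open>m\<close> the packing number at radius
  \<open>1 / (5 * sqrt n)\<close>, and minus the logarithm of this radius is about half of
  \<open>log 2 n\<close>.\<close>

lemma C_DI_dot_upper:
  assumes "X \<noteq> {}"
  shows "C_DI_dot d X W \<le> lower_minkowski_dim (W ` X) / 2"
proof -
  have "C_DI_dot d X W
      \<le> liminf (\<lambda>n. elog2 (N_DI d X W n (1 / 4) (1 / 4)) / ereal (real n * log 2 (real n)))"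
    unfolding C_DI_dot_def by (rule INF_lower2[of "(1 / 4, 1 / 4)"]) auto
  also have "\<dots> \<le> liminf (\<lambda>n. ereal (pack (1 / (5 * sqrt (real n))) / log 2 (real n)))"
  proof (rule Liminf_mono)
    have "eventually (\<lambda>n::nat. 2 \<le> n) sequentially" by (rule eventually_ge_at_top)
    then show "eventually (\<lambda>n. elog2 (N_DI d X W n (1 / 4) (1 / 4)) / ereal (real n * log 2 (real n))
        \<le> ereal (pack (1 / (5 * sqrt (real n))) / log 2 (real n))) sequentially"
    proof eventually_elim
      case (elim n)
      \<comment> \<open>With this radius \<open>16 * n * ?\<delta>\<^sup>2\<close> equals
        \<open>16 / 25\<close>, which is below 1 as \<open>N_DI_upper\<close> demands.\<close>
      let ?\<delta> = "1 / (5 * sqrt (real n))"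
      define m where "m = the_enat (packing_number (W ` X) ?\<delta>)"
      have d: "0 < ?\<delta>" using elim by simp
      have ln0: "0 < log 2 (real n)" and lp: "0 < real n * log 2 (real n)" using elim by simp_all
      have m0: "0 < m" using pack_pos[OF assms d] by (simp add: m_def)
      have "N_DI d X W n (1 / 4) (1 / 4) \<le> enat (m ^ n)"
        using elim packing_number_enat[OF d]
        by (intro N_DI_upper[OF d]) (simp_all add: m_def power_mult_distrib power_divide)
      then have "elog2 (N_DI d X W n (1 / 4) (1 / 4)) / ereal (real n * log 2 (real n))
          \<le> ereal (log 2 (real (m ^ n))) / ereal (real n * log 2 (real n))"
        using lp elog2_mono[of _ "enat (m ^ n)"]
        by (intro ereal_divide_right_mono) (auto simp: elog2_enat)
      also have "\<dots> = ereal (pack ?\<delta> / log 2 (real n))"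
        using m0 elim by (simp add: log_nat_power m_def less_imp_neq[OF ln0, symmetric])
      finally show ?case .
    qed
  qed
  finally have le: "C_DI_dot d X W \<le> liminf (\<lambda>n. ereal (pack (1 / (5 * sqrt (real n))) / log 2 (real n)))" .
  show ?thesis
  proof (rule ereal_le_via_reals)
    fix c assume "ereal c < C_DI_dot d X W"
    then have "ereal c < liminf (\<lambda>n. ereal (pack (1 / (5 * sqrt (real n))) / log 2 (real n)))"
      using le by (rule less_le_trans)
    then have "ereal (2 * c) \<le> lower_minkowski_dim (W ` X)"
      unfolding lower_minkowski_dim_eq
      using pack_nonneg[OF assms] pack_antimono[OF assms]
      by (intro Liminf_at_right_ge_of_sequence[where p = pack]) auto
    then show "ereal c \<le> lower_minkowski_dim (W ` X) / 2"
      by (cases "lower_minkowski_dim (W ` X)") auto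
  qed
qed

text \<open>For any positive errors, each level \<open>c\<close> below half the dimension is
  eventually reached by the codes of \<open>N_DI_lower\<close>, with the packing radius shrinking
  and the distance \<open>k\<close> growing with \<open>n\<close>.\<close>

lemma C_DI_dot_lower:
  assumes ne: "X \<noteq> {}"
  shows "lower_minkowski_dim (W ` X) / 2 \<le> C_DI_dot d X W"
  unfolding C_DI_dot_def
proof (rule INF_greatest)
  fix l :: "real \<times> real" assume "l \<in> {0<..} \<times> {0<..}"
  then obtain l1 l2 where l: "l = (l1, l2)" "0 < l1" "0 < l2" by auto
  let ?r = "\<lambda>n. elog2 (N_DI d X W n l1 l2) / ereal (real n * log 2 (real n))"
  have "lower_minkowski_dim (W ` X) / 2 \<le> liminf ?r"
  proof (rule ereal_le_via_reals)
    fix c assume c: "ereal c < lower_minkowski_dim (W ` X) / 2"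
    show "ereal c \<le> liminf ?r"
    \<comment> \<open>Negative levels follow from nonnegativity of the ratio; otherwise
      \<open>c'\<close> below is positive and can be divided by.\<close>
    proof (cases "c < 0")
      case True
      have "ereal c \<le> ?r n" for n
        using True by (intro order_trans[OF _ elog2_ratio_nonneg]) simp
      then show ?thesis by (intro Liminf_bounded always_eventually allI)
    next
      case False
      obtain c' where c': "ereal c < ereal c'" "ereal c' < lower_minkowski_dim (W ` X) / 2"
        using ereal_dense2[OF c] by blast
      then have cc: "c < c'" "0 < c'" using False by auto
      have "ereal (2 * c') < lower_minkowski_dim (W ` X)"
        using c'(2) by (cases "lower_minkowski_dim (W ` X)") auto
      then have "eventually (\<lambda>\<delta>. 2 * c' < pack \<delta> / (- log 2 \<delta>)) (at_right 0)"
        unfolding lower_minkowski_dim_eq using less_LiminfD by force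
      then have pk: "eventually (\<lambda>\<delta>. 2 * c' * (- log 2 \<delta>) \<le> pack \<delta>) (at_right 0)"
        using eventually_at_right_real[of 0 1, simplified]
      proof eventually_elim
        case (elim \<delta>)
        then have "0 < - log 2 \<delta>" by simp
        then show ?case using elim(1) by (simp only: pos_less_divide_eq less_imp_le)
      qed
      \<comment> \<open>With this choice the loss \<open>2 * (c' * s)\<close> in expanding
        \<open>c' * (1 - s)\<^sup>2\<close> uses up only half of the gap \<open>c' - c\<close>,
        which leaves the slack \<open>e\<close> positive.\<close>
      define s where "s = (c' - c) / (4 * c')"
      have s: "0 < s" "s < 1" using cc False by (auto simp: s_def field_simps)
      define e where "e = c' * (1 - s)\<^sup>2 - c"
      have cs: "c' * s = (c' - c) / 4" using cc by (simp add: s_def)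
      have "e = c' - c - 2 * (c' * s) + c' * s\<^sup>2"
        by (simp add: e_def power2_eq_square algebra_simps)
      then have "e = (c' - c) / 2 + c' * s\<^sup>2" unfolding cs by (simp add: field_simps)
      then have e: "0 < e" using cc by (simp add: add_pos_nonneg)
      \<comment> \<open>The square of \<open>dl n\<close> times \<open>s * n\<close> is
        \<open>s * n powr s\<close>, which still diverges and drives the second error to 0, while
        \<open>- log 2 (dl n)\<close> falls short of half of \<open>log 2 n\<close> only by the
        factor \<open>1 - s\<close>.\<close>
      define dl where "dl n = real n powr (- (1 - s) / 2)" for n :: nat
      have "filterlim dl (at_right 0) sequentially"
        unfolding dl_def using s by real_asymp
      then have ev1: "eventually (\<lambda>n. 2 * c' * (- log 2 (dl n)) \<le> pack (dl n)) sequentially"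
        using pk by (rule eventually_compose_filterlim[rotated])
      \<comment> \<open>The \<open>- 1\<close> allows for rounding \<open>s * n\<close> down to the
        integer \<open>k\<close>.\<close>
      have "((\<lambda>n. exp (- (real n powr (- (1 - s)) / 2 * (s * real n - 1)))) \<longlongrightarrow> 0) sequentially"
        using s by real_asymp
      then have ev2: "eventually (\<lambda>n. exp (- (real n powr (- (1 - s)) / 2 * (s * real n - 1))) < l2) sequentially"
        using l(3) by (rule order_tendstoD)
      \<comment> \<open>The slack \<open>e\<close> pays for the factor \<open>2 ^ n\<close> in the
        size of a Hamming ball: its logarithm \<open>n\<close> is eventually at most
        \<open>e * n * log 2 n\<close>.\<close>
      have ev3: "eventually (\<lambda>n. 1 \<le> e * log 2 (real n)) sequentially"
        using e by real_asymp
      have ev4: "eventually (\<lambda>n::nat. 2 \<le> n) sequentially" by (rule eventually_ge_at_top)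
      have "eventually (\<lambda>n. ereal c \<le> ?r n) sequentially"
        using ev1 ev2 ev3 ev4
      proof eventually_elim
        case (elim n)
        let ?\<delta> = "dl n"
        have n: "0 < real n" using elim by simp
        have lp: "0 < real n * log 2 (real n)" using elim by simp
        have d0: "0 < ?\<delta>" using n by (simp add: dl_def)
        have d1: "?\<delta> \<le> 1" 
          using powr_mono[of "- (1 - s) / 2" 0 "real n"] elim s by (simp add: dl_def)
        have d2: "?\<delta>\<^sup>2 = real n powr (- (1 - s))"
          using n by (simp add: dl_def power2_eq_square flip: powr_add)
        define k where "k = nat \<lfloor>s * real n\<rfloor>"
        have "0 \<le> s * real n" using s n by simp
        then have k: "real k \<le> s * real n" "s * real n - 1 \<le> real k"
          unfolding k_def by linarith+
        have "s * real n \<le> real n" using s by (simp add: mult_left_le_one_le)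
        then have "real k \<le> real n" using k(1) by linarith
        then have kn: "k \<le> n" by simp
        obtain S where S: "S \<subseteq> W ` X" "finite S" "separated ?\<delta> S" "packing_number (W ` X) ?\<delta> = enat (card S)"
          by (rule packing_number_attained[OF outputs_bounded d0]) blast
        have q: "0 < card S" "pack ?\<delta> = log 2 (card S)" using pack_pos[OF ne d0] S(4) by auto
        have "(1 - ?\<delta>\<^sup>2 / 2) ^ k \<le> exp (- (?\<delta>\<^sup>2 / 2)) ^ k"
          using exp_ge_add_one_self[of "- (?\<delta>\<^sup>2 / 2)"] power_le_one[of ?\<delta> 2] d0 d1
          by (intro power_mono) auto
        also have "\<dots> = exp (- (?\<delta>\<^sup>2 / 2 * k))" by (simp flip: exp_of_nat_mult)
        also have "\<dots> \<le> exp (- (?\<delta>\<^sup>2 / 2 * (s * real n - 1)))"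
          using k by (simp add: mult_left_mono)
        also have "\<dots> \<le> l2" using elim by (simp add: d2)
        finally have dec: "(1 - ?\<delta>\<^sup>2 / 2) ^ k \<le> l2" .
        have "S \<noteq> {}" using q by auto
        obtain N where N: "enat N \<le> N_DI d X W n l1 l2" "card S ^ n \<le> N * (2 ^ n * card S ^ k)"
          by (rule N_DI_lower[OF S(1,2) \<open>S \<noteq> {}\<close> S(3) d0 d1 l(2) dec]) blast
        have "- log 2 ?\<delta> = (1 - s) / 2 * log 2 (real n)"
          using n by (simp add: dl_def log_powr field_simps)
        then have "c' * (1 - s) * log 2 (real n) \<le> log 2 (card S)"
          using elim q by (simp add: algebra_simps)
        moreover have "(1 - s) * real n \<le> real n - real k" using k by (simp add: algebra_simps)
        \<comment> \<open>One factor \<open>1 - s\<close> is the share of the word length left after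
          the Hamming radius, the other comes from the exponent of \<open>dl\<close>; together they
          form the square in \<open>e\<close>.\<close>
        ultimately have "((1 - s) * real n) * (c' * (1 - s) * log 2 (real n)) \<le> (real n - real k) * log 2 (card S)"
          using s cc elim q kn by (intro mult_mono) auto
        also have "\<dots> \<le> log 2 N + n" using log_code_size_ge[OF q(1) N(2)] by simp
        finally have "(e + c) * (real n * log 2 (real n)) \<le> log 2 N + n"
          by (simp add: e_def power2_eq_square algebra_simps)
        moreover have "real n \<le> real n * (e * log 2 (real n))" using elim by simp
        ultimately have "c * (real n * log 2 (real n)) \<le> log 2 N" by (simp add: algebra_simps)
        then have "c \<le> log 2 N / (real n * log 2 (real n))"
          using lp by (simp only: pos_le_divide_eq)
        moreover have "real n * log 2 (real n) \<noteq> 0" using lp by linarith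
        ultimately have "ereal c \<le> ereal (log 2 N) / ereal (real n * log 2 (real n))"
          by (simp only: ereal_divide if_False ereal_less_eq)
        also have "\<dots> \<le> ?r n"
          using lp elog2_mono[OF N(1)] by (intro ereal_divide_right_mono) (auto simp: elog2_enat)
        finally show ?case .
      qed
      then show ?thesis by (rule Liminf_bounded)
    qed
  qed
  then show "lower_minkowski_dim (W ` X) / 2
      \<le> liminf (\<lambda>n. elog2 (N_DI d X W n (fst l) (snd l)) / ereal (real n * log 2 (real n)))"
    by (simp add: l)
qed

end

theorem theorem5:
  fixes d :: nat and X :: "'a set" and W :: "'a \<Rightarrow> complex mat"
  assumes "X \<noteq> {}"
    and "cq_channel d X W"
    and pure: "\<forall>x\<in>X. \<exists>\<psi>. unit_vector d \<psi> \<and> W x = proj_vec d \<psi>"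
  shows "C_DI_dot d X W = lower_minkowski_dim (mat_sqrt ` (W ` X)) / 2
       \<and> lower_minkowski_dim (mat_sqrt ` (W ` X)) / 2 = lower_minkowski_dim (W ` X) / 2"
proof -
  obtain \<psi> where \<psi>: "\<And>x. x \<in> X \<Longrightarrow> unit_vector d (\<psi> x) \<and> W x = proj_vec d (\<psi> x)"
    using pure by metis
  interpret pure_channel d X W \<psi> by unfold_locales (use \<psi> in auto)
  have "mat_sqrt ` (W ` X) = W ` X"
    using \<psi> mat_sqrt_proj_vec by (force simp: image_image intro!: image_cong)
  then show ?thesis
    using C_DI_dot_upper C_DI_dot_lower \<open>X \<noteq> {}\<close> by (simp add: antisym)
qed

end
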